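(* Let $\tau\colon\mathbb{T}\curvearrowright\mathcal{O}_\infty$ denote the gauge action on the Cuntz algebra $\mathcal{O}_\infty$ and let $\mathcal{O}_\infty^{\mathbb{T}}$ denote the fixed point subalgebra of $\tau$. Then $$\mathrm{Aut}_{\mathcal{O}_\infty^{\mathbb{T}}}(\mathcal{O}_\infty)=\{\tau_z\in\mathrm{Aut}(\mathcal{O}_\infty)\mid z\in\mathbb{T}\}\ (\simeq\mathbb{T})$$ holds.
   Context: $\mathcal{O}_\infty$ is the universal unital C*-algebra generated by isometries $\{S_i\}_{i=1}^\infty$ with $S_i^*S_j=\delta_{i,j}1$. The gauge action $\tau$ of the circle group $\mathbb{T}$ is determined by $\tau_z(S_i)=zS_i$ for all $i$ and $z\in\mathbb{T}$, and $\mathcal{O}_\infty^{\mathbb{T}}=\{a\in\mathcal{O}_\infty:\tau_z(a)=a\ \forall z\in\mathbb{T}\}$. For C*-algebras $B\subset A$, $\mathrm{Aut}_B(A)=\{\varphi\in\mathrm{Aut}(A):\varphi(b)=b\text{ for all }b\in B\}$. *)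

theory Defs
  imports
    "HOL-Analysis.Analysis"
    "HOL-Algebra.Module"
    "HOL-Algebra.Bij"
begin

text \<open>
  The algebras are carrier based, in the style of HOL-Algebra, because the universal property of
  the Cuntz algebra quantifies over C*-algebras inside a formula.
\<close>

definition complex_ring :: "complex ring" where
  "complex_ring = \<lparr>carrier = UNIV, mult = (*), one = 1, zero = 0, add = (+)\<rparr>"

record 'a star_algebra = "(complex, 'a) module" +
  star :: "'a \<Rightarrow> 'a"
  nrm :: "'a \<Rightarrow> real"

text \<open>
  \<^locale>\<open>Metric_space\<close> requires nonnegativity and symmetry on the whole type, so the distance is
  cut off outside the carrier.
\<close>

definition norm_dist :: "'a star_algebra \<Rightarrow> 'a \<Rightarrow> 'a \<Rightarrow> real" where
  "norm_dist A x y = (if x \<in> carrier A \<and> y \<in> carrier A then nrm A (x \<ominus>\<^bsub>A\<^esub> y) else 0)"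

abbreviation norm_topology :: "'a star_algebra \<Rightarrow> 'a topology" where
  "norm_topology A \<equiv> Metric_space.mtopology (carrier A) (norm_dist A)"

text \<open>
  The zero algebra is excluded, as in \<^class>\<open>real_normed_algebra_1\<close>.
\<close>

locale unital_cstar_algebra = Module.module complex_ring A + ring A
  for A :: "'a star_algebra" (structure) +
  assumes one_neq_zero: "\<one> \<noteq> \<zero>"
    and smult_mult_left:
      "\<lbrakk>x \<in> carrier A; y \<in> carrier A\<rbrakk> \<Longrightarrow> (c \<odot> x) \<otimes> y = c \<odot> (x \<otimes> y)"
    and smult_mult_right:
      "\<lbrakk>x \<in> carrier A; y \<in> carrier A\<rbrakk> \<Longrightarrow> x \<otimes> (c \<odot> y) = c \<odot> (x \<otimes> y)"
    and star_closed: "x \<in> carrier A \<Longrightarrow> star A x \<in> carrier A"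
    and star_star: "x \<in> carrier A \<Longrightarrow> star A (star A x) = x"
    and star_add:
      "\<lbrakk>x \<in> carrier A; y \<in> carrier A\<rbrakk> \<Longrightarrow> star A (x \<oplus> y) = star A x \<oplus> star A y"
    and star_mult:
      "\<lbrakk>x \<in> carrier A; y \<in> carrier A\<rbrakk> \<Longrightarrow> star A (x \<otimes> y) = star A y \<otimes> star A x"
    and star_smult: "x \<in> carrier A \<Longrightarrow> star A (c \<odot> x) = cnj c \<odot> star A x"
    and nrm_nonneg: "x \<in> carrier A \<Longrightarrow> 0 \<le> nrm A x"
    and nrm_eq_zero: "x \<in> carrier A \<Longrightarrow> nrm A x = 0 \<longleftrightarrow> x = \<zero>"
    and nrm_add: "\<lbrakk>x \<in> carrier A; y \<in> carrier A\<rbrakk> \<Longrightarrow> nrm A (x \<oplus> y) \<le> nrm A x + nrm A y"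
    and nrm_smult: "x \<in> carrier A \<Longrightarrow> nrm A (c \<odot> x) = cmod c * nrm A x"
    and nrm_mult: "\<lbrakk>x \<in> carrier A; y \<in> carrier A\<rbrakk> \<Longrightarrow> nrm A (x \<otimes> y) \<le> nrm A x * nrm A y"
    and cstar_identity: "x \<in> carrier A \<Longrightarrow> nrm A (star A x \<otimes> x) = (nrm A x)\<^sup>2"
    and complete: "Metric_space.mcomplete (carrier A) (norm_dist A)"

lemma (in unital_cstar_algebra) Metric_space_norm_dist:
  "Metric_space (carrier A) (norm_dist A)"
proof
  have minus: "x \<ominus> y = x \<oplus> ((- 1) \<odot> y)" if "x \<in> carrier A" "y \<in> carrier A" for x y
  proof -
    have [simp]: "c \<odot> y \<in> carrier A" for c
      using smult_closed[of c y] that by (simp add: complex_ring_def)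
    have *: "(a + b) \<odot> y = a \<odot> y \<oplus> b \<odot> y" for a b
      using smult_l_distr[of a b y] that by (simp add: complex_ring_def)
    have one: "1 \<odot> y = y"
      using smult_one[of y] that by (simp add: complex_ring_def)
    have "0 \<odot> y \<oplus> 0 \<odot> y = 0 \<odot> y"
      using *[of 0 0] by simp
    then have "0 \<odot> y = \<zero>"
      using M.add.r_cancel_one[of "0 \<odot> y" "0 \<odot> y"] by simp
    then have "y \<oplus> (- 1) \<odot> y = \<zero>"
      using *[of 1 "-1"] one by simp
    then show ?thesis
      using that by (simp add: M.minus_eq M.minus_equality M.a_comm)
  qed
  have neg: "nrm A ((- 1) \<odot> x) = nrm A x" if "x \<in> carrier A" for x
    using nrm_smult[of x "-1"] that by simp
  have swap: "nrm A (x \<ominus> y) = nrm A (y \<ominus> x)" if "x \<in> carrier A" "y \<in> carrier A" for x y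
  proof -
    have "y \<ominus> x = \<ominus> (x \<ominus> y)"
      using that by (simp add: M.minus_eq M.minus_add M.a_comm)
    also have "\<dots> = (- 1) \<odot> (x \<ominus> y)"
      using minus[of \<zero> "x \<ominus> y"] smult_closed[of "-1" "x \<ominus> y"] that
      by (simp add: M.minus_eq complex_ring_def)
    finally show ?thesis
      using neg[of "x \<ominus> y"] that by simp
  qed
  show "0 \<le> norm_dist A x y" for x y
    by (simp add: norm_dist_def nrm_nonneg)
  show "norm_dist A x y = norm_dist A y x" for x y
    by (simp add: norm_dist_def swap)
  show "norm_dist A x y = 0 \<longleftrightarrow> x = y" if "x \<in> carrier A" "y \<in> carrier A" for x y
    using that M.minus_equality[of x "\<ominus> y"] by (auto simp: norm_dist_def nrm_eq_zero M.minus_eq M.r_neg)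
  show "norm_dist A x z \<le> norm_dist A x y + norm_dist A y z"
    if "x \<in> carrier A" "y \<in> carrier A" "z \<in> carrier A" for x y z
  proof -
    have "x \<ominus> z = (x \<ominus> y) \<oplus> (y \<ominus> z)"
      using that by (simp add: M.minus_eq M.a_assoc M.r_neg2 M.r_neg1)
    then show ?thesis
      using that nrm_add[of "x \<ominus> y" "y \<ominus> z"] by (simp add: norm_dist_def)
  qed
qed

text \<open>\<^const>\<open>ring_hom\<close> includes preservation of the unit.\<close>

definition star_hom :: "'a star_algebra \<Rightarrow> 'b star_algebra \<Rightarrow> ('a \<Rightarrow> 'b) set" where
  "star_hom A B = {f \<in> ring_hom A B.
     (\<forall>c. \<forall>x\<in>carrier A. f (c \<odot>\<^bsub>A\<^esub> x) = c \<odot>\<^bsub>B\<^esub> f x) \<and>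
     (\<forall>x\<in>carrier A. f (star A x) = star B (f x))}"

text \<open>
  Automorphisms are represented by functions that are undefined outside the carrier, as in
  \<^const>\<open>Bij\<close>, so that equality of automorphisms is equality of functions.
\<close>

definition cstar_aut :: "'a star_algebra \<Rightarrow> ('a \<Rightarrow> 'a) set" where
  "cstar_aut A = star_hom A A \<inter> Bij (carrier A)"

definition cstar_aut_fixing :: "'a star_algebra \<Rightarrow> 'a set \<Rightarrow> ('a \<Rightarrow> 'a) set" where
  "cstar_aut_fixing A B = {\<phi> \<in> cstar_aut A. \<forall>b\<in>B. \<phi> b = b}"

definition Aut_fixing_group :: "'a star_algebra \<Rightarrow> 'a set \<Rightarrow> ('a \<Rightarrow> 'a) monoid" where
  "Aut_fixing_group A B = BijGroup (carrier A) \<lparr>carrier := cstar_aut_fixing A B\<rparr>"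

definition point_norm_topology :: "'a star_algebra \<Rightarrow> ('a \<Rightarrow> 'a) set \<Rightarrow> ('a \<Rightarrow> 'a) topology" where
  "point_norm_topology A F =
     subtopology (product_topology (\<lambda>_. norm_topology A) (carrier A)) F"

definition unital_cstar_subalgebra :: "'a set \<Rightarrow> 'a star_algebra \<Rightarrow> bool" where
  "unital_cstar_subalgebra B A \<longleftrightarrow>
     B \<subseteq> carrier A \<and> \<one>\<^bsub>A\<^esub> \<in> B \<and>
     (\<forall>x\<in>B. \<forall>y\<in>B. x \<oplus>\<^bsub>A\<^esub> y \<in> B \<and> x \<otimes>\<^bsub>A\<^esub> y \<in> B) \<and>
     (\<forall>c. \<forall>x\<in>B. c \<odot>\<^bsub>A\<^esub> x \<in> B) \<and>
     (\<forall>x\<in>B. star A x \<in> B) \<and>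
     closedin (norm_topology A) B"

definition cstar_generated :: "'a star_algebra \<Rightarrow> 'a set \<Rightarrow> 'a set" where
  "cstar_generated A G = \<Inter>{B. unital_cstar_subalgebra B A \<and> G \<subseteq> B}"

text \<open>The generators are indexed by \<^typ>\<open>nat\<close>, starting at 0. The case \<open>i = j\<close> says that they
  are isometries.\<close>

definition cuntz_family :: "'a star_algebra \<Rightarrow> (nat \<Rightarrow> 'a) \<Rightarrow> bool" where
  "cuntz_family A S \<longleftrightarrow>
     (\<forall>i. S i \<in> carrier A) \<and>
     (\<forall>i j. star A (S i) \<otimes>\<^bsub>A\<^esub> S j = (if i = j then \<one>\<^bsub>A\<^esub> else \<zero>\<^bsub>A\<^esub>))"

text \<open>
  \<open>A\<close> together with \<open>S\<close> is the universal unital C*-algebra generated by a sequence of isometries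
  with pairwise orthogonal ranges. Uniqueness of the induced homomorphism follows from
  generation by \<open>S\<close>.

  HOL cannot quantify over types inside a formula, so \<open>B\<close> ranges over the C*-algebras whose carrier
  is a subset of the type \<open>'a\<close> itself. This loses nothing: \<open>A\<close> contains a nonzero Cuntz family, so
  it is infinite dimensional and \<open>'a\<close> has at least continuum many elements, whereas the
  C*-subalgebra generated by a Cuntz family in an arbitrary C*-algebra is separable, has at most
  continuum many elements, and is therefore isomorphic to one with carrier in \<open>'a\<close>.
\<close>

definition is_Cuntz_infinity :: "'a star_algebra \<Rightarrow> (nat \<Rightarrow> 'a) \<Rightarrow> bool" where
  "is_Cuntz_infinity A S \<longleftrightarrow>
     unital_cstar_algebra A \<and>
     cuntz_family A S \<and>
     cstar_generated A (range S) = carrier A \<and>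
     (\<forall>(B :: 'a star_algebra) T. unital_cstar_algebra B \<and> cuntz_family B T \<longrightarrow>
        (\<exists>f \<in> star_hom A B. \<forall>i. f (S i) = T i))"

abbreviation unit_circle :: "complex set" where
  "unit_circle \<equiv> sphere 0 1"

definition circle_group :: "complex monoid" where
  "circle_group = \<lparr>carrier = unit_circle, mult = (*), one = 1\<rparr>"

definition gauge_action :: "'a star_algebra \<Rightarrow> (nat \<Rightarrow> 'a) \<Rightarrow> complex \<Rightarrow> 'a \<Rightarrow> 'a" where
  "gauge_action A S z = (THE \<tau>. \<tau> \<in> cstar_aut A \<and> (\<forall>i. \<tau> (S i) = z \<odot>\<^bsub>A\<^esub> S i))"

definition gauge_fixed :: "'a star_algebra \<Rightarrow> (nat \<Rightarrow> 'a) \<Rightarrow> 'a set" where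
  "gauge_fixed A S = {a \<in> carrier A. \<forall>z\<in>unit_circle. gauge_action A S z a = a}"

end

theory Submission
  imports Defs
begin

text \<open>
  An automorphism \<open>\<phi>\<close> fixing the core (the gauge-fixed subalgebra) fixes each \<open>S\<^sub>i S\<^sub>j\<^sup>*\<close>, which forces \<open>\<phi>(S\<^sub>i) = S\<^sub>i u\<close> for a
  unitary \<open>u\<close> independent of \<open>i\<close>; comparing \<open>\<phi>(S\<^sub>0 a S\<^sub>0\<^sup>*)\<close> with \<open>S\<^sub>0 a S\<^sub>0\<^sup>*\<close> shows that \<open>u\<close> commutes
  with the core. It remains to see that \<open>u\<close> is a scalar. Since \<open>u\<close> commutes with all
  \<open>S\<^sub>i S\<^sub>j\<^sup>*\<close>, the element \<open>S\<^sub>k\<^sup>* u S\<^sub>k\<close> is the same for all \<open>k\<close>. Compressing a fixed linear combination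
  of words by \<open>S\<^sub>k\<close> with \<open>k\<close> large leaves only the coefficient of the empty word, so
  \<open>S\<^sub>k\<^sup>* u S\<^sub>k\<close> is a scalar \<open>c\<close> and \<open>w = u - c\<close> satisfies \<open>w S\<^sub>k = 0 = S\<^sub>k\<^sup>* w\<close>. Approximating \<open>w\<^sup>*\<close> by
  words yields \<open>w w\<^sup>* w = 0\<close>, hence \<open>w = 0\<close>.

  Continuity rests on *-homomorphisms being contractive, which needs no spectral theory: a
  selfadjoint \<open>h\<close> of norm less than 1 is the real part of the unitary \<open>h + i (1 - h\<^sup>2)\<^sup>1\<^sup>/\<^sup>2\<close>, and
  homomorphisms preserve unitaries, which have norm 1.
\<close>

section \<open>Arithmetic in a unital C*-algebra\<close>

context unital_cstar_algebra begin

lemma scale_closed [simp, intro]: "x \<in> carrier A \<Longrightarrow> c \<odot> x \<in> carrier A"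
  using smult_closed[of c x] by (simp add: complex_ring_def)

lemma scale_add: "\<lbrakk>x \<in> carrier A; y \<in> carrier A\<rbrakk> \<Longrightarrow> c \<odot> (x \<oplus> y) = c \<odot> x \<oplus> c \<odot> y"
  using smult_r_distr[of c x y] by (simp add: complex_ring_def)

lemma add_scale: "x \<in> carrier A \<Longrightarrow> (c + d) \<odot> x = c \<odot> x \<oplus> d \<odot> x"
  using smult_l_distr[of c d x] by (simp add: complex_ring_def)

lemma scale_scale: "x \<in> carrier A \<Longrightarrow> c \<odot> (d \<odot> x) = (c * d) \<odot> x"
  using smult_assoc1[of c d x] by (simp add: complex_ring_def)

lemma scale_one [simp]: "x \<in> carrier A \<Longrightarrow> 1 \<odot> x = x"
  using smult_one[of x] by (simp add: complex_ring_def)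

lemma scale_zero_left [simp]: "x \<in> carrier A \<Longrightarrow> 0 \<odot> x = \<zero>"
  using add_scale[of x 0 0] by (simp add: M.add.r_cancel_one)

lemma scale_zero_right [simp]: "c \<odot> \<zero> = \<zero>"
  using scale_scale[of \<zero> c 0] by simp

lemma scale_minus_one: "x \<in> carrier A \<Longrightarrow> (- 1) \<odot> x = \<ominus> x"
  using add_scale[of x "-1" 1] M.minus_equality[of "(- 1) \<odot> x" x] by simp

lemma scale_uminus: "x \<in> carrier A \<Longrightarrow> (- c) \<odot> x = \<ominus> (c \<odot> x)"
  using scale_minus_one[of "c \<odot> x"] by (simp add: scale_scale)

lemma scale_diff: "\<lbrakk>x \<in> carrier A; y \<in> carrier A\<rbrakk> \<Longrightarrow> c \<odot> (x \<ominus> y) = c \<odot> x \<ominus> c \<odot> y"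
  by (simp add: minus_eq scale_add flip: scale_minus_one) (simp add: scale_scale)

lemma diff_scale: "x \<in> carrier A \<Longrightarrow> (c - d) \<odot> x = c \<odot> x \<ominus> d \<odot> x"
  using add_scale[of x c "- d"] by (simp add: minus_eq scale_uminus)

declare star_closed [simp, intro] star_star [simp] nrm_nonneg [simp]

lemma star_zero [simp]: "star A \<zero> = \<zero>"
  using star_smult[of \<zero> 0] by simp

lemma star_one [simp]: "star A \<one> = \<one>"
  using star_mult[of "star A \<one>" \<one>] by simp

lemma star_minus: "x \<in> carrier A \<Longrightarrow> star A (\<ominus> x) = \<ominus> star A x"
  using star_smult[of x "-1"] by (simp add: scale_minus_one)

lemma star_diff:
  "\<lbrakk>x \<in> carrier A; y \<in> carrier A\<rbrakk> \<Longrightarrow> star A (x \<ominus> y) = star A x \<ominus> star A y"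
  by (simp add: minus_eq star_add star_minus)

lemma nrm_zero [simp]: "nrm A \<zero> = 0"
  by (simp add: nrm_eq_zero)

lemma nrm_minus: "x \<in> carrier A \<Longrightarrow> nrm A (\<ominus> x) = nrm A x"
  using nrm_smult[of x "-1"] by (simp add: scale_minus_one)

lemma diff_self [simp]: "x \<in> carrier A \<Longrightarrow> x \<ominus> x = \<zero>"
  by (simp add: minus_eq M.r_neg)

lemma nrm_diff_commute:
  assumes "x \<in> carrier A" "y \<in> carrier A"
  shows "nrm A (x \<ominus> y) = nrm A (y \<ominus> x)"
proof -
  have "x \<ominus> y = \<ominus> (y \<ominus> x)"
    using assms by algebra
  with assms show ?thesis
    by (simp add: nrm_minus)
qed

lemma nrm_diff_triangle:
  assumes "x \<in> carrier A" "y \<in> carrier A" "z \<in> carrier A"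
  shows "nrm A (x \<ominus> z) \<le> nrm A (x \<ominus> y) + nrm A (y \<ominus> z)"
proof -
  have "x \<ominus> z = (x \<ominus> y) \<oplus> (y \<ominus> z)"
    using assms by algebra
  with assms show ?thesis
    by (simp add: nrm_add)
qed

lemma eq_if_diff_zero: "\<lbrakk>x \<in> carrier A; y \<in> carrier A; x \<ominus> y = \<zero>\<rbrakk> \<Longrightarrow> x = y"
  using M.minus_equality[of x "\<ominus> y"] by (simp add: minus_eq)

lemma nrm_one [simp]: "nrm A \<one> = 1"
  using cstar_identity[of \<one>] nrm_eq_zero[of \<one>] one_neq_zero by (simp add: power2_eq_square)

lemma nrm_isometry:
  assumes "u \<in> carrier A" "star A u \<otimes> u = \<one>"
  shows "nrm A u = 1"
proof -
  have "(nrm A u)\<^sup>2 = 1"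
    using cstar_identity[of u] assms by simp
  moreover have "0 \<le> nrm A u"
    using assms by simp
  ultimately show ?thesis
    by (auto simp: power2_eq_1_iff)
qed

text \<open>The C*-identity bounds the square of \<open>nrm A y\<close> by
  \<open>nrm A (star A y) * nrm A y\<close>. Cancelling \<open>nrm A y\<close> gives one inequality,
  and passing to the adjoint gives the other.\<close>

lemma nrm_star [simp]:
  assumes "x \<in> carrier A"
  shows "nrm A (star A x) = nrm A x"
proof -
  have *: "nrm A y \<le> nrm A (star A y)" if "y \<in> carrier A" for y
  proof (cases "nrm A y = 0")
    case False
    have "nrm A y * nrm A y \<le> nrm A (star A y) * nrm A y"
      using cstar_identity[OF that] nrm_mult[of "star A y" y] that by (simp add: power2_eq_square)
    then show ?thesis
      using False nrm_nonneg[OF that] by simp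
  qed (use that in simp)
  show ?thesis
    using *[OF assms] *[of "star A x"] assms by simp
qed

lemma nrm_mult_le:
  assumes "x \<in> carrier A" "y \<in> carrier A" "nrm A x \<le> a" "nrm A y \<le> b"
  shows "nrm A (x \<otimes> y) \<le> a * b"
  using nrm_mult[of x y] mult_mono[of "nrm A x" a "nrm A y" b] assms
  by (smt (verit) nrm_nonneg)

section \<open>Unitaries from Banach's fixed point theorem\<close>

text \<open>Differences of squares and commutators with a square factor in this way,
  \<open>w\<close> being the difference or commutator of the unsquared elements. For
  \<open>r < 1\<close> the estimate is a contraction.\<close>

lemma nrm_half_sandwich:
  assumes "y \<in> carrier A" "w \<in> carrier A" "z \<in> carrier A" "nrm A y \<le> r" "nrm A z \<le> r"
  shows "nrm A ((1/2) \<odot> (y \<otimes> w \<oplus> w \<otimes> z)) \<le> r * nrm A w"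
proof -
  have "nrm A (y \<otimes> w \<oplus> w \<otimes> z) \<le> r * nrm A w + nrm A w * r"
    using nrm_add[of "y \<otimes> w" "w \<otimes> z"] nrm_mult_le[of y w r "nrm A w"]
      nrm_mult_le[of w z "nrm A w" r] assms by (simp add: mult.commute)
  then show ?thesis
    using assms by (simp add: nrm_smult)
qed

text \<open>For \<open>a = h\<^sup>2\<close> the element \<open>1 - y\<close> is a square root of \<open>1 - h\<^sup>2\<close>.\<close>

lemma half_square_fixed_point:
  assumes a: "a \<in> carrier A" "nrm A a \<le> r * r" and r: "0 \<le> r" "r < 1"
  obtains y where "y \<in> carrier A" "nrm A y \<le> r" "y = (1/2) \<odot> (a \<oplus> y \<otimes> y)"
proof -
  interpret D: Metric_space "carrier A" "norm_dist A"
    by (rule Metric_space_norm_dist)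
  have dist0: "norm_dist A \<zero> y = nrm A y" if "y \<in> carrier A" for y
    using that by (simp add: norm_dist_def nrm_diff_commute[of \<zero>] minus_eq nrm_minus)
  interpret S: Submetric "carrier A" "norm_dist A" "D.mcball \<zero> r"
    by unfold_locales auto
  let ?F = "\<lambda>y. (1/2) \<odot> (a \<oplus> y \<otimes> y)"
  have "S.sub.mcomplete"
    using S.closedin_mcomplete_imp_mcomplete complete by simp
  moreover have "D.mcball \<zero> r \<noteq> {}"
    using r by (auto simp: D.mcball_eq_empty)
  moreover have "?F \<in> D.mcball \<zero> r \<rightarrow> D.mcball \<zero> r"
  proof
    fix y assume "y \<in> D.mcball \<zero> r"
    then have y: "y \<in> carrier A" "nrm A y \<le> r"
      using dist0 by auto
    have "nrm A (a \<oplus> y \<otimes> y) \<le> r * r + r * r"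
      using nrm_add[of a "y \<otimes> y"] nrm_mult_le[of y y r r] a y by simp
    also have "\<dots> \<le> r + r"
      using r by (simp add: mult_left_le)
    finally show "?F y \<in> D.mcball \<zero> r"
      using a y dist0 by (simp add: nrm_smult)
  qed
  moreover have "norm_dist A (?F y) (?F z) \<le> r * norm_dist A y z"
    if "y \<in> D.mcball \<zero> r" "z \<in> D.mcball \<zero> r" for y z
  proof -
    have y: "y \<in> carrier A" "nrm A y \<le> r" and z: "z \<in> carrier A" "nrm A z \<le> r"
      using dist0 that by auto
    \<comment> \<open>\<open>y\<close> and \<open>z\<close> may fail to commute, so the difference
      of squares is split with \<open>y\<close> on the left and \<open>z\<close> on the
      right.\<close>
    have "(a \<oplus> y \<otimes> y) \<ominus> (a \<oplus> z \<otimes> z) = y \<otimes> (y \<ominus> z) \<oplus> (y \<ominus> z) \<otimes> z"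
      using a y z by algebra
    then have "?F y \<ominus> ?F z = (1/2) \<odot> (y \<otimes> (y \<ominus> z) \<oplus> (y \<ominus> z) \<otimes> z)"
      using a y z by (metis scale_diff a_closed m_closed)
    then show ?thesis
      using nrm_half_sandwich[of y "y \<ominus> z" z r] a y z by (simp add: norm_dist_def)
  qed
  ultimately obtain y where "y \<in> D.mcball \<zero> r" "?F y = y"
    using S.sub.Banach_fixedpoint_thm[of ?F r] \<open>r < 1\<close> by blast
  then show thesis
    using that[of y] dist0 by auto
qed

lemma zero_if_nrm_le_contraction:
  assumes "w \<in> carrier A" "nrm A w \<le> r * nrm A w" "r < 1"
  shows "w = \<zero>"
proof (rule ccontr)
  assume "w \<noteq> \<zero>"
  then have "0 < nrm A w"
    using assms(1) nrm_eq_zero[of w] nrm_nonneg[of w] by linarith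
  then show False
    using assms(2,3) by simp
qed

text \<open>Let \<open>y\<close> be the fixed point for \<open>a = h \<otimes> h\<close> and
  \<open>k = \<one> \<ominus> y\<close>. Then \<open>u = h \<oplus> \<i> \<odot> k\<close> works
  because \<open>k\<close> is selfadjoint, commutes with \<open>h\<close> and has square
  \<open>\<one> \<ominus> h \<otimes> h\<close>.\<close>

lemma selfadjoint_real_part_of_unitary:
  assumes h: "h \<in> carrier A" "star A h = h" "nrm A h < 1"
  obtains u where "u \<in> carrier A" "star A u \<otimes> u = \<one>" "h = (1/2) \<odot> (u \<oplus> star A u)"
proof -
  define r where "r = nrm A h"
  have r: "0 \<le> r" "r < 1"
    using h by (auto simp: r_def)
  have "nrm A (h \<otimes> h) \<le> r * r"
    using h by (simp add: r_def nrm_mult)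
  then obtain y where y: "y \<in> carrier A" "nrm A y \<le> r" "y = (1/2) \<odot> (h \<otimes> h \<oplus> y \<otimes> y)"
    using half_square_fixed_point[of "h \<otimes> h" r] h r by auto
  have sy: "star A y \<in> carrier A" "nrm A (star A y) \<le> r"
    using y by auto
  \<comment> \<open>As \<open>h\<close> is selfadjoint, \<open>star A y\<close> solves the same
    fixed point equation; the contraction estimate then forces \<open>y \<ominus> star A y\<close>
    to vanish.\<close>
  have "star A y = (1/2) \<odot> (h \<otimes> h \<oplus> star A y \<otimes> star A y)"
    using h y(1) by (subst y(3)) (simp add: star_smult star_add star_mult)
  then have "y \<ominus> star A y
      = (1/2) \<odot> (h \<otimes> h \<oplus> y \<otimes> y) \<ominus> (1/2) \<odot> (h \<otimes> h \<oplus> star A y \<otimes> star A y)"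
    using y(3) by simp
  also have "\<dots> = (1/2) \<odot> ((h \<otimes> h \<oplus> y \<otimes> y) \<ominus> (h \<otimes> h \<oplus> star A y \<otimes> star A y))"
    using h y(1) sy by (simp add: scale_diff)
  also have "(h \<otimes> h \<oplus> y \<otimes> y) \<ominus> (h \<otimes> h \<oplus> star A y \<otimes> star A y)
      = y \<otimes> (y \<ominus> star A y) \<oplus> (y \<ominus> star A y) \<otimes> star A y"
    using h(1) y(1) sy(1) by algebra
  finally have "nrm A (y \<ominus> star A y) \<le> r * nrm A (y \<ominus> star A y)"
    using nrm_half_sandwich[of y "y \<ominus> star A y" "star A y" r] y(1,2) sy by simp
  then have "y \<ominus> star A y = \<zero>"
    using zero_if_nrm_le_contraction[of "y \<ominus> star A y" r] y(1) sy r by simp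
  then have star_y: "star A y = y"
    using eq_if_diff_zero[of y "star A y"] y(1) by simp
  \<comment> \<open>The same argument for the commutator with \<open>h\<close>: the cubes of
    \<open>h\<close> cancel, and the rest expands by the Leibniz rule.\<close>
  have "y \<otimes> h \<ominus> h \<otimes> y
      = (1/2) \<odot> (h \<otimes> h \<oplus> y \<otimes> y) \<otimes> h \<ominus> h \<otimes> ((1/2) \<odot> (h \<otimes> h \<oplus> y \<otimes> y))"
    using y(3) by simp
  also have "\<dots> = (1/2) \<odot> ((h \<otimes> h \<oplus> y \<otimes> y) \<otimes> h \<ominus> h \<otimes> (h \<otimes> h \<oplus> y \<otimes> y))"
    using h y(1) by (simp add: scale_diff smult_mult_left smult_mult_right)
  also have "(h \<otimes> h \<oplus> y \<otimes> y) \<otimes> h \<ominus> h \<otimes> (h \<otimes> h \<oplus> y \<otimes> y)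
      = y \<otimes> (y \<otimes> h \<ominus> h \<otimes> y) \<oplus> (y \<otimes> h \<ominus> h \<otimes> y) \<otimes> y"
    using h(1) y(1) by algebra
  finally have "nrm A (y \<otimes> h \<ominus> h \<otimes> y) \<le> r * nrm A (y \<otimes> h \<ominus> h \<otimes> y)"
    using nrm_half_sandwich[of y "y \<otimes> h \<ominus> h \<otimes> y" y r] y(1,2) h by simp
  then have "y \<otimes> h \<ominus> h \<otimes> y = \<zero>"
    using zero_if_nrm_le_contraction[of "y \<otimes> h \<ominus> h \<otimes> y" r] y(1) h r by simp
  then have comm: "y \<otimes> h = h \<otimes> y"
    using eq_if_diff_zero[of "y \<otimes> h" "h \<otimes> y"] y(1) h by simp
  define k where "k = \<one> \<ominus> y"
  have k: "k \<in> carrier A" "star A k = k"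
    using y star_y by (auto simp: k_def star_diff)
  have yy: "y \<oplus> y = h \<otimes> h \<oplus> y \<otimes> y"
  proof -
    have "y \<oplus> y = (1/2 + 1/2) \<odot> (h \<otimes> h \<oplus> y \<otimes> y)"
      using y h add_scale[of "h \<otimes> h \<oplus> y \<otimes> y" "1/2" "1/2"] by simp
    then show ?thesis
      using h y(1) by simp
  qed
  have "h \<otimes> h \<oplus> k \<otimes> k = \<one> \<ominus> (y \<oplus> y \<otimes> \<one>) \<oplus> (h \<otimes> h \<oplus> y \<otimes> y)"
    unfolding k_def using h(1) y(1) by algebra
  also have "\<dots> = \<one> \<ominus> (y \<oplus> y) \<oplus> (h \<otimes> h \<oplus> y \<otimes> y)"
    using y(1) by simp
  also have "\<dots> = \<one>"
    unfolding yy using h(1) y(1) by algebra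
  finally have sum: "h \<otimes> h \<oplus> k \<otimes> k = \<one>" .
  have hk: "h \<otimes> k = k \<otimes> h"
  proof -
    have "h \<otimes> k = h \<ominus> h \<otimes> y" "k \<otimes> h = h \<ominus> y \<otimes> h"
      using h(1) y(1) by (simp_all add: k_def minus_eq r_distr l_distr r_minus l_minus)
    then show ?thesis
      using comm by simp
  qed
  \<comment> \<open>\<open>v\<close> is skew-adjoint and commutes with \<open>h\<close>, so the
    cross terms of \<open>star A (h \<oplus> v) \<otimes> (h \<oplus> v)\<close> cancel.\<close>
  define v where "v = \<i> \<odot> k"
  have v: "v \<in> carrier A" "star A v = \<ominus> v" "h \<otimes> v = v \<otimes> h" "v \<otimes> v = \<ominus> (k \<otimes> k)"
    using k h hk by (auto simp: v_def star_smult scale_uminus smult_mult_left smult_mult_right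
        scale_scale scale_minus_one)
  show thesis
  proof
    show "h \<oplus> v \<in> carrier A"
      using h v by simp
    have star_u: "star A (h \<oplus> v) = h \<ominus> v"
      using h v by (simp add: star_add minus_eq)
    have "star A (h \<oplus> v) \<otimes> (h \<oplus> v) = h \<otimes> h \<oplus> h \<otimes> v \<ominus> v \<otimes> h \<ominus> v \<otimes> v"
      unfolding star_u using h(1) v(1) by algebra
    also have "\<dots> = h \<otimes> h \<oplus> k \<otimes> k"
      unfolding v(3,4) using h(1) v(1) k(1) by algebra
    finally show "star A (h \<oplus> v) \<otimes> (h \<oplus> v) = \<one>"
      using sum by simp
    have "(h \<oplus> v) \<oplus> star A (h \<oplus> v) = h \<oplus> h"
      unfolding star_u using h(1) v(1) by algebra
    then show "h = (1/2) \<odot> ((h \<oplus> v) \<oplus> star A (h \<oplus> v))"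
      using h add_scale[of h "1/2" "1/2"] by (simp add: scale_add)
  qed
qed

end

section \<open>Contractivity of star homomorphisms\<close>

lemma star_hom_closed: "f \<in> star_hom A B \<Longrightarrow> x \<in> carrier A \<Longrightarrow> f x \<in> carrier B"
  and star_hom_mult: "f \<in> star_hom A B \<Longrightarrow> x \<in> carrier A \<Longrightarrow> y \<in> carrier A
        \<Longrightarrow> f (x \<otimes>\<^bsub>A\<^esub> y) = f x \<otimes>\<^bsub>B\<^esub> f y"
  and star_hom_add: "f \<in> star_hom A B \<Longrightarrow> x \<in> carrier A \<Longrightarrow> y \<in> carrier A
        \<Longrightarrow> f (x \<oplus>\<^bsub>A\<^esub> y) = f x \<oplus>\<^bsub>B\<^esub> f y"
  and star_hom_one: "f \<in> star_hom A B \<Longrightarrow> f \<one>\<^bsub>A\<^esub> = \<one>\<^bsub>B\<^esub>"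
  and star_hom_smult: "f \<in> star_hom A B \<Longrightarrow> x \<in> carrier A
        \<Longrightarrow> f (c \<odot>\<^bsub>A\<^esub> x) = c \<odot>\<^bsub>B\<^esub> f x"
  and star_hom_star: "f \<in> star_hom A B \<Longrightarrow> x \<in> carrier A \<Longrightarrow> f (star A x) = star B (f x)"
  by (auto simp: star_hom_def ring_hom_def)

lemmas star_hom_simps = star_hom_closed star_hom_mult star_hom_add star_hom_one star_hom_smult
  star_hom_star

text \<open>Homomorphisms from the universal property are arbitrary off the carrier, whereas
  elements of \<open>cstar_aut\<close> are undefined there.\<close>

lemma star_hom_restrict:
  assumes "f \<in> star_hom A B" "unital_cstar_algebra A"
  shows "restrict f (carrier A) \<in> star_hom A B"
proof -
  interpret unital_cstar_algebra A by fact
  show ?thesis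
    using assms(1) by (auto simp: star_hom_def ring_hom_def Pi_iff)
qed

locale cstar_hom = A: unital_cstar_algebra A + B: unital_cstar_algebra B
  for A :: "'a star_algebra" and B :: "'b star_algebra" +
  fixes f
  assumes hom: "f \<in> star_hom A B"
begin

lemmas hom_simps = star_hom_simps[OF hom]

lemma hom_diff:
  assumes "x \<in> carrier A" "y \<in> carrier A"
  shows "f (x \<ominus>\<^bsub>A\<^esub> y) = f x \<ominus>\<^bsub>B\<^esub> f y"
proof -
  have "x \<ominus>\<^bsub>A\<^esub> y = x \<oplus>\<^bsub>A\<^esub> (- 1) \<odot>\<^bsub>A\<^esub> y"
    using assms by (simp add: A.minus_eq A.scale_minus_one)
  then show ?thesis
    using assms by (simp add: hom_simps B.minus_eq B.scale_minus_one)
qed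

text \<open>\<open>h\<close> is the mean of an isometry \<open>u\<close> and its adjoint, and
  \<open>f u\<close> is again an isometry, hence of norm 1 together with its adjoint.\<close>

lemma nrm_hom_le_1:
  assumes h: "h \<in> carrier A" "star A h = h" "nrm A h < 1"
  shows "nrm B (f h) \<le> 1"
proof -
  obtain u where u: "u \<in> carrier A" "star A u \<otimes>\<^bsub>A\<^esub> u = \<one>\<^bsub>A\<^esub>"
      "h = (1/2) \<odot>\<^bsub>A\<^esub> (u \<oplus>\<^bsub>A\<^esub> star A u)"
    using A.selfadjoint_real_part_of_unitary[OF h] .
  have "star B (f u) \<otimes>\<^bsub>B\<^esub> f u = \<one>\<^bsub>B\<^esub>"
    using u(1,2) hom_simps by (metis A.star_closed)
  then have "nrm B (f u) = 1"
    using B.nrm_isometry u(1) hom_simps by blast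
  moreover have "f h = (1/2) \<odot>\<^bsub>B\<^esub> (f u \<oplus>\<^bsub>B\<^esub> star B (f u))"
    using u(1) by (simp add: u(3) hom_simps)
  ultimately show ?thesis
    using B.nrm_add[of "f u" "star B (f u)"] u(1) by (simp add: B.nrm_smult hom_simps)
qed

text \<open>Dividing \<open>h\<close> by any \<open>t\<close> above its norm reduces to the open
  unit ball; then \<open>t\<close> decreases to \<open>nrm A h\<close>.\<close>

lemma nrm_hom_selfadjoint_le:
  assumes h: "h \<in> carrier A" "star A h = h"
  shows "nrm B (f h) \<le> nrm A h"
proof (rule dense_ge)
  fix t assume t: "nrm A h < t"
  then have "0 < t"
    using A.nrm_nonneg[OF h(1)] by linarith
  let ?g = "of_real (1 / t) \<odot>\<^bsub>A\<^esub> h"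
  have "nrm A ?g < 1"
    using t \<open>0 < t\<close> h by (simp add: A.nrm_smult norm_divide)
  then have "nrm B (f ?g) \<le> 1"
    using nrm_hom_le_1[of ?g] h by (simp add: A.star_smult)
  then show "nrm B (f h) \<le> t"
    using \<open>0 < t\<close> h by (simp add: hom_simps B.nrm_smult norm_divide field_simps)
qed

text \<open>The C*-identity in both algebras reduces the claim to the selfadjoint element
  \<open>star A x \<otimes> x\<close>.\<close>

lemma nrm_hom_le:
  assumes "x \<in> carrier A"
  shows "nrm B (f x) \<le> nrm A x"
proof (rule power2_le_imp_le)
  have "(nrm B (f x))\<^sup>2 = nrm B (f (star A x \<otimes>\<^bsub>A\<^esub> x))"
    using assms by (simp add: hom_simps B.cstar_identity)
  also have "\<dots> \<le> nrm A (star A x \<otimes>\<^bsub>A\<^esub> x)"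
    using assms by (intro nrm_hom_selfadjoint_le) (auto simp: A.star_mult)
  also have "\<dots> = (nrm A x)\<^sup>2"
    using assms by (simp add: A.cstar_identity)
  finally show "(nrm B (f x))\<^sup>2 \<le> (nrm A x)\<^sup>2" .
qed (use assms in simp)

end

section \<open>Closures of unital star subalgebras\<close>

context unital_cstar_algebra begin

lemma eq_if_nrm_diff_small:
  assumes "x \<in> carrier A" "y \<in> carrier A" "\<And>e. 0 < e \<Longrightarrow> nrm A (x \<ominus> y) \<le> e"
  shows "x = y"
proof -
  have "nrm A (x \<ominus> y) \<le> 0"
    using assms(3) by (rule field_le_epsilon[of _ 0, simplified])
  then have "nrm A (x \<ominus> y) = 0"
    using assms(1,2) by (simp add: order_antisym)
  then show ?thesis
    using assms(1,2) eq_if_diff_zero[of x y] nrm_eq_zero[of "x \<ominus> y"] by simp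
qed

text \<open>The set is the norm closure of \<open>D\<close>, so only the algebraic operations have
  to be carried over to limits. This will give density of the span of words.\<close>

lemma closure_unital_star_subalgebra:
  assumes "D \<subseteq> carrier A" "\<one> \<in> D"
    and add: "\<And>x y. x \<in> D \<Longrightarrow> y \<in> D \<Longrightarrow> x \<oplus> y \<in> D"
    and mult: "\<And>x y. x \<in> D \<Longrightarrow> y \<in> D \<Longrightarrow> x \<otimes> y \<in> D"
    and smult: "\<And>c x. x \<in> D \<Longrightarrow> c \<odot> x \<in> D"
    and star: "\<And>x. x \<in> D \<Longrightarrow> star A x \<in> D"
  shows "unital_cstar_subalgebra {x \<in> carrier A. \<forall>e>0. \<exists>y\<in>D. nrm A (x \<ominus> y) < e} A"
    (is "unital_cstar_subalgebra ?C A")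
proof -
  interpret M: Metric_space "carrier A" "norm_dist A"
    by (rule Metric_space_norm_dist)
  note [simp, intro] = subsetD[OF \<open>D \<subseteq> carrier A\<close>]
  have "?C = M.mtopology closure_of D"
    by (auto simp: M.metric_closure_of norm_dist_def)
  then have closed: "closedin M.mtopology ?C"
    by simp
  have D: "x \<in> ?C" if "x \<in> D" for x
    using that by (auto intro!: bexI[of _ x])
  have add': "x \<oplus> y \<in> ?C" if x: "x \<in> ?C" and y: "y \<in> ?C" for x y
  proof -
    have "\<exists>w\<in>D. nrm A (x \<oplus> y \<ominus> w) < e" if "0 < e" for e
    proof -
      obtain x' y' where x': "x' \<in> D" "nrm A (x \<ominus> x') < e / 2"
        and y': "y' \<in> D" "nrm A (y \<ominus> y') < e / 2"
        using x y \<open>0 < e\<close> half_gt_zero by blast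
      have closed [simp]: "x \<in> carrier A" "y \<in> carrier A" "x' \<in> carrier A" "y' \<in> carrier A"
        using x y x' y' by auto
      have "x \<oplus> y \<ominus> (x' \<oplus> y') = (x \<ominus> x') \<oplus> (y \<ominus> y')"
        using closed by algebra
      then have "nrm A (x \<oplus> y \<ominus> (x' \<oplus> y')) < e"
        using nrm_add[of "x \<ominus> x'" "y \<ominus> y'"] x' y' by simp
      then show ?thesis
        using add x' y' by blast
    qed
    then show ?thesis
      using x y by auto
  qed
  have mult': "x \<otimes> y \<in> ?C" if x: "x \<in> ?C" and y: "y \<in> ?C" for x y
  proof -
    have "\<exists>w\<in>D. nrm A (x \<otimes> y \<ominus> w) < e" if "0 < e" for e
    proof -
      have x_closed [simp]: "x \<in> carrier A" "y \<in> carrier A"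
        using x y by auto
      \<comment> \<open>The error splits as \<open>(x \<ominus> x') \<otimes> y \<oplus> x'
        \<otimes> (y \<ominus> y')\<close>, so \<open>x'\<close> is chosen before the tolerance for
        \<open>y'\<close>. The added 1 avoids division by zero.\<close>
      define d where "d = e / 2 / (nrm A y + 1)"
      have "0 < d"
        using \<open>0 < e\<close> nrm_nonneg[of y] unfolding d_def by (simp add: add_nonneg_pos)
      then obtain x' where x': "x' \<in> D" "nrm A (x \<ominus> x') < d"
        using x by blast
      have x'_closed [simp]: "x' \<in> carrier A"
        using x' by auto
      define d' where "d' = e / 2 / (nrm A x' + 1)"
      have "0 < d'"
        using \<open>0 < e\<close> nrm_nonneg[of x'] unfolding d'_def by (simp add: add_nonneg_pos)
      then obtain y' where y': "y' \<in> D" "nrm A (y \<ominus> y') < d'"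
        using y by blast
      have y'_closed [simp]: "y' \<in> carrier A"
        using y' by auto
      have bound: "e / 2 / (t + 1) * t < e / 2" if "0 \<le> t" for t
        using that \<open>0 < e\<close> by (simp add: field_simps)
      have "d * nrm A y < e / 2"
        unfolding d_def by (rule bound) simp
      moreover have "nrm A x' * d' < e / 2"
        unfolding d'_def by (subst mult.commute, rule bound) simp
      moreover have "x \<otimes> y \<ominus> x' \<otimes> y' = (x \<ominus> x') \<otimes> y \<oplus> x' \<otimes> (y \<ominus> y')"
        using x_closed x'_closed y'_closed by algebra
      moreover have "nrm A ((x \<ominus> x') \<otimes> y) \<le> d * nrm A y"
        using x' by (intro nrm_mult_le) auto
      moreover have "nrm A (x' \<otimes> (y \<ominus> y')) \<le> nrm A x' * d'"
        using y' by (intro nrm_mult_le) auto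
      ultimately have "nrm A (x \<otimes> y \<ominus> x' \<otimes> y') < e"
        using nrm_add[of "(x \<ominus> x') \<otimes> y" "x' \<otimes> (y \<ominus> y')"] by simp
      then show ?thesis
        using mult x' y' by blast
    qed
    then show ?thesis
      using x y by auto
  qed
  have smult': "c \<odot> x \<in> ?C" if x: "x \<in> ?C" for c x
  proof (cases "c = 0")
    case False
    have "\<exists>w\<in>D. nrm A (c \<odot> x \<ominus> w) < e" if "0 < e" for e
    proof -
      have "0 < e / cmod c"
        using False \<open>0 < e\<close> by simp
      then obtain x' where x': "x' \<in> D" "nrm A (x \<ominus> x') < e / cmod c"
        using x by blast
      have "nrm A (c \<odot> x \<ominus> c \<odot> x') < e"
        using x x' False by (simp add: nrm_smult field_simps flip: scale_diff)
      then show ?thesis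
        using smult x' by blast
    qed
    then show ?thesis
      using x by auto
  \<comment> \<open>For \<open>c = 0\<close>, where \<open>e / cmod c\<close> is no usable
    tolerance, the product is \<open>\<zero> = 0 \<odot> \<one>\<close>, an element of
    \<open>D\<close>.\<close>
  qed (use x D[OF smult[OF \<open>\<one> \<in> D\<close>, of 0]] in auto)
  have star': "star A x \<in> ?C" if x: "x \<in> ?C" for x
  proof -
    have "\<exists>w\<in>D. nrm A (star A x \<ominus> w) < e" if "0 < e" for e
    proof -
      obtain x' where x': "x' \<in> D" "nrm A (x \<ominus> x') < e"
        using x \<open>0 < e\<close> by blast
      then have "nrm A (star A x \<ominus> star A x') < e"
        using x by (simp flip: star_diff)
      then show ?thesis
        using star x' by blast
    qed
    then show ?thesis
      using x by auto
  qed
  have "?C \<subseteq> carrier A"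
    by blast
  then show ?thesis
    unfolding unital_cstar_subalgebra_def
    by (intro conjI ballI allI D[OF \<open>\<one> \<in> D\<close>] add' mult' smult' star' closed)
qed

end

section \<open>Words in the generators\<close>

locale cuntz_infinity = unital_cstar_algebra A
  for A :: "'a star_algebra" (structure) +
  fixes S :: "nat \<Rightarrow> 'a"
  assumes Cuntz: "is_Cuntz_infinity A S"
begin

lemma gen_closed [simp, intro]: "S i \<in> carrier A"
  and star_gen_mult_gen: "star A (S i) \<otimes> S j = (if i = j then \<one> else \<zero>)"
  using Cuntz by (auto simp: is_Cuntz_infinity_def cuntz_family_def)

lemma nrm_gen [simp]: "nrm A (S i) = 1"
  using star_gen_mult_gen[of i i] by (intro nrm_isometry) auto

text \<open>The linear span of the words \<open>S\<^sub>\<mu> S\<^sub>\<nu>\<^sup>*\<close>, with \<open>S\<^sub>\<mu>\<close>, \<open>S\<^sub>\<nu>\<close> products of generators.\<close>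

inductive_set word_span :: "'a set" where
  one: "\<one> \<in> word_span"
| gen_mult: "x \<in> word_span \<Longrightarrow> S i \<otimes> x \<in> word_span"
| mult_star_gen: "x \<in> word_span \<Longrightarrow> x \<otimes> star A (S i) \<in> word_span"
| add: "x \<in> word_span \<Longrightarrow> y \<in> word_span \<Longrightarrow> x \<oplus> y \<in> word_span"
| smult: "x \<in> word_span \<Longrightarrow> c \<odot> x \<in> word_span"

lemma word_span_closed [simp, intro]: "x \<in> word_span \<Longrightarrow> x \<in> carrier A"
  by (induction rule: word_span.induct) auto

lemma zero_in_word_span: "\<zero> \<in> word_span"
  using word_span.smult[OF word_span.one, of 0] by simp

text \<open>Left multiplication by \<open>star A (S i)\<close> cancels a leading \<open>S i\<close>,
  kills any other leading generator, and otherwise joins the starred part.\<close>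

lemma star_gen_mult_word_span: "x \<in> word_span \<Longrightarrow> star A (S i) \<otimes> x \<in> word_span"
proof (induction rule: word_span.induct)
  case one
  then show ?case
    using word_span.mult_star_gen[OF word_span.one, of i] by simp
next
  case (gen_mult x j)
  have "star A (S i) \<otimes> (S j \<otimes> x) = (if i = j then x else \<zero>)"
    using gen_mult by (simp add: star_gen_mult_gen flip: m_assoc)
  then show ?case
    using gen_mult zero_in_word_span by simp
next
  case (mult_star_gen x j)
  then show ?case
    using word_span.mult_star_gen[of "star A (S i) \<otimes> x" j] by (simp add: m_assoc)
next
  case (add x y)
  then show ?case
    using word_span.add by (simp add: r_distr)
next
  case (smult x c)
  then show ?case
    using word_span.smult by (simp add: smult_mult_right)
qed

text \<open>A starred letter at the end of \<open>x\<close> is moved onto \<open>y\<close> and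
  absorbed there, hence \<open>y\<close> is arbitrary in the induction.\<close>

lemma word_span_mult: "x \<in> word_span \<Longrightarrow> y \<in> word_span \<Longrightarrow> x \<otimes> y \<in> word_span"
proof (induction arbitrary: y rule: word_span.induct)
  case (gen_mult x i)
  then show ?case
    using word_span.gen_mult[of "x \<otimes> y" i] by (simp add: m_assoc)
next
  case (mult_star_gen x i)
  then show ?case
    using star_gen_mult_word_span by (simp add: m_assoc)
next
  case (add x z)
  then show ?case
    using word_span.add by (simp add: l_distr)
next
  case (smult x c)
  then show ?case
    using word_span.smult by (simp add: smult_mult_left)
qed simp

lemma star_word_span: "x \<in> word_span \<Longrightarrow> star A x \<in> word_span"
proof (induction rule: word_span.induct)
  case (gen_mult x i)
  then show ?case
    using word_span.mult_star_gen by (simp add: star_mult)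
next
  case (mult_star_gen x i)
  then show ?case
    using word_span.gen_mult by (simp add: star_mult)
qed (auto simp: star_add star_smult intro: word_span.intros)

text \<open>The closure of \<open>word_span\<close> is a unital C*-subalgebra containing the
  \<open>S i\<close>, which generate the whole algebra.\<close>

lemma word_span_dense:
  assumes "x \<in> carrier A" "0 < e"
  obtains y where "y \<in> word_span" "nrm A (x \<ominus> y) < e"
proof -
  let ?C = "{x \<in> carrier A. \<forall>e>0. \<exists>y\<in>word_span. nrm A (x \<ominus> y) < e}"
  have "unital_cstar_subalgebra ?C A"
    by (intro closure_unital_star_subalgebra)
      (auto intro: word_span.intros word_span_mult star_word_span)
  moreover have "S i \<in> ?C" for i
    using word_span.gen_mult[OF word_span.one, of i]
    by (auto intro!: bexI[of _ "S i"])
  ultimately have "cstar_generated A (range S) \<subseteq> ?C"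
    unfolding cstar_generated_def by blast
  then show thesis
    using assms that Cuntz unfolding is_Cuntz_infinity_def by blast
qed

end

section \<open>Scalars, compressions by generators and commutants\<close>

context unital_cstar_algebra begin

text \<open>As \<open>\<one>\<close> has norm 1, distances between multiples of
  \<open>\<one>\<close> are distances in the complex plane; the approximating scalars form a Cauchy
  sequence, whose limit is \<open>c\<close>.\<close>

lemma scalars_closed:
  assumes q: "q \<in> carrier A" and approx: "\<And>e. 0 < e \<Longrightarrow> \<exists>c. nrm A (q \<ominus> c \<odot> \<one>) < e"
  obtains c where "q = c \<odot> \<one>"
proof -
  have "\<exists>c. nrm A (q \<ominus> c \<odot> \<one>) < inverse (real (Suc n))" for n
    by (rule approx) simp
  then obtain c where c: "nrm A (q \<ominus> c n \<odot> \<one>) < inverse (real (Suc n))" for n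
    by metis
  have dist: "cmod (a - b) \<le> nrm A (q \<ominus> a \<odot> \<one>) + nrm A (q \<ominus> b \<odot> \<one>)" for a b
  proof -
    have "cmod (a - b) = nrm A (a \<odot> \<one> \<ominus> b \<odot> \<one>)"
      by (simp add: nrm_smult flip: diff_scale)
    then show ?thesis
      using nrm_diff_triangle[of "a \<odot> \<one>" q "b \<odot> \<one>"] q
      by (simp add: nrm_diff_commute[of q "a \<odot> \<one>"])
  qed
  have "Cauchy c"
  proof (rule metric_CauchyI)
    fix e :: real assume "0 < e"
    then obtain N where N: "inverse (real (Suc N)) < e / 2"
      using reals_Archimedean half_gt_zero by blast
    have "dist (c m) (c n) < e" if "N \<le> m" "N \<le> n" for m n
    proof -
      have "inverse (real (Suc m)) \<le> inverse (real (Suc N))"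
        "inverse (real (Suc n)) \<le> inverse (real (Suc N))"
        using that by (auto intro!: le_imp_inverse_le)
      then show ?thesis
        using dist[of "c m" "c n"] c[of m] c[of n] N unfolding dist_norm by linarith
    qed
    then show "\<exists>M. \<forall>m\<ge>M. \<forall>n\<ge>M. dist (c m) (c n) < e"
      by blast
  qed
  then obtain l where l: "c \<longlonglongrightarrow> l"
    using Cauchy_convergent convergent_def by blast
  have "nrm A (q \<ominus> l \<odot> \<one>) \<le> e" if "0 < e" for e
  proof -
    have "\<forall>\<^sub>F n in sequentially. dist (c n) l < e / 2"
      using l \<open>0 < e\<close> by (intro tendstoD) auto
    moreover have "\<forall>\<^sub>F n in sequentially. inverse (real (Suc n)) < e / 2"
      using LIMSEQ_inverse_real_of_nat \<open>0 < e\<close> by (intro order_tendstoD) auto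
    ultimately have "\<forall>\<^sub>F n in sequentially. dist (c n) l < e / 2 \<and> inverse (real (Suc n)) < e / 2"
      by (rule eventually_conj)
    then obtain n where "dist (c n) l < e / 2" "inverse (real (Suc n)) < e / 2"
      by (auto simp: eventually_sequentially)
    moreover have "nrm A (c n \<odot> \<one> \<ominus> l \<odot> \<one>) = dist (c n) l"
      by (simp add: nrm_smult dist_norm flip: diff_scale)
    ultimately show ?thesis
      using nrm_diff_triangle[of q "c n \<odot> \<one>" "l \<odot> \<one>"] c[of n] q by simp
  qed
  then have "q = l \<odot> \<one>"
    using q by (intro eq_if_nrm_diff_small) auto
  then show thesis ..
qed

end

context cuntz_infinity begin

text \<open>The scalar \<open>c\<close> is the coefficient of the empty word \<open>1\<close> in \<open>x\<close>.\<close>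

lemma word_span_compression:
  assumes "x \<in> word_span"
  obtains c N where "\<And>k. N \<le> k \<Longrightarrow> star A (S k) \<otimes> x \<otimes> S k = c \<odot> \<one>"
    and "\<And>w. \<lbrakk>w \<in> carrier A; \<And>k. w \<otimes> S k = \<zero>; \<And>k. star A (S k) \<otimes> w = \<zero>\<rbrakk>
           \<Longrightarrow> w \<otimes> x \<otimes> w = c \<odot> (w \<otimes> w)"
proof -
  \<comment> \<open>Both conclusions refer to the same \<open>c\<close>, so they are proved in one
    induction.\<close>
  have "\<exists>c N. (\<forall>k\<ge>N. star A (S k) \<otimes> x \<otimes> S k = c \<odot> \<one>) \<and>
      (\<forall>w\<in>carrier A. (\<forall>k. w \<otimes> S k = \<zero> \<and> star A (S k) \<otimes> w = \<zero>)
         \<longrightarrow> w \<otimes> x \<otimes> w = c \<odot> (w \<otimes> w))"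
    using assms
  proof (induction rule: word_span.induct)
    case one
    show ?case
      by (intro exI[of _ 1] exI[of _ 0]) (auto simp: star_gen_mult_gen)
  next
    case (gen_mult x i)
    \<comment> \<open>From \<open>Suc i\<close> on, \<open>S k\<close> has range orthogonal to that
      of \<open>S i\<close>, so a product starting with \<open>S i\<close> has coefficient
      0.\<close>
    have "star A (S k) \<otimes> (S i \<otimes> x) \<otimes> S k = 0 \<odot> \<one>" if "Suc i \<le> k" for k
      using that gen_mult by (simp add: star_gen_mult_gen flip: m_assoc)
    moreover have "w \<otimes> (S i \<otimes> x) \<otimes> w = 0 \<odot> (w \<otimes> w)"
      if "w \<in> carrier A" "\<forall>k. w \<otimes> S k = \<zero> \<and> star A (S k) \<otimes> w = \<zero>" for w
      using that gen_mult by (simp flip: m_assoc)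
    ultimately show ?case
      by blast
  next
    case (mult_star_gen x i)
    have "star A (S k) \<otimes> (x \<otimes> star A (S i)) \<otimes> S k = 0 \<odot> \<one>" if "Suc i \<le> k" for k
      using that mult_star_gen by (simp add: star_gen_mult_gen m_assoc)
    moreover have "w \<otimes> (x \<otimes> star A (S i)) \<otimes> w = 0 \<odot> (w \<otimes> w)"
      if "w \<in> carrier A" "\<forall>k. w \<otimes> S k = \<zero> \<and> star A (S k) \<otimes> w = \<zero>" for w
      using that mult_star_gen by (simp add: m_assoc)
    ultimately show ?case
      by blast
  next
    case (add x y)
    then obtain c M d N where *:
      "\<And>k. M \<le> k \<Longrightarrow> star A (S k) \<otimes> x \<otimes> S k = c \<odot> \<one>"
      "\<And>k. N \<le> k \<Longrightarrow> star A (S k) \<otimes> y \<otimes> S k = d \<odot> \<one>"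
      "\<forall>w\<in>carrier A. (\<forall>k. w \<otimes> S k = \<zero> \<and> star A (S k) \<otimes> w = \<zero>)
         \<longrightarrow> w \<otimes> x \<otimes> w = c \<odot> (w \<otimes> w)"
      "\<forall>w\<in>carrier A. (\<forall>k. w \<otimes> S k = \<zero> \<and> star A (S k) \<otimes> w = \<zero>)
         \<longrightarrow> w \<otimes> y \<otimes> w = d \<odot> (w \<otimes> w)"
      by blast
    show ?case
      by (rule exI[of _ "c + d"], rule exI[of _ "max M N"])
        (use * add in \<open>simp add: r_distr l_distr add_scale\<close>)
  next
    case (smult x c)
    then obtain d N where *:
      "\<And>k. N \<le> k \<Longrightarrow> star A (S k) \<otimes> x \<otimes> S k = d \<odot> \<one>"
      "\<forall>w\<in>carrier A. (\<forall>k. w \<otimes> S k = \<zero> \<and> star A (S k) \<otimes> w = \<zero>)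
         \<longrightarrow> w \<otimes> x \<otimes> w = d \<odot> (w \<otimes> w)"
      by blast
    show ?case
      by (rule exI[of _ "c * d"], rule exI[of _ N])
        (use * smult in \<open>simp add: smult_mult_left smult_mult_right scale_scale\<close>)
  qed
  then show thesis
    using that by blast
qed

lemma nrm_compression_le:
  assumes "x \<in> carrier A"
  shows "nrm A (star A (S k) \<otimes> x \<otimes> S k) \<le> nrm A x"
  using assms nrm_mult_le[of "star A (S k) \<otimes> x" "S k" "nrm A x" 1]
    nrm_mult_le[of "star A (S k)" x 1 "nrm A x"] by simp

text \<open>This expresses that the vacuum projection of the Fock representation is missing in
  \<open>\<O>\<^sub>\<infinity>\<close>. Approximating \<open>w\<^sup>*\<close> by a combination of words gives \<open>w w\<^sup>* w = 0\<close>.\<close>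

lemma annihilator_of_generators:
  assumes w: "w \<in> carrier A" "\<And>k. w \<otimes> S k = \<zero>" "\<And>k. star A (S k) \<otimes> w = \<zero>"
  shows "w = \<zero>"
proof -
  have "nrm A (w \<otimes> star A w \<otimes> w) \<le> e" if "0 < e" for e
  proof -
    define b where "b = nrm A w * nrm A w"
    have "0 \<le> b"
      using w by (simp add: b_def)
    \<comment> \<open>Two errors of size at most \<open>d * b\<close> will arise; the added 1 keeps
      the denominator positive when \<open>b = 0\<close>.\<close>
    define d where "d = e / (2 * b + 1)"
    have "0 < d"
      using \<open>0 < e\<close> \<open>0 \<le> b\<close> by (simp add: d_def)
    then obtain x where x: "x \<in> word_span" "nrm A (star A w \<ominus> x) < d"
      using word_span_dense[of "star A w" d] w by blast
    obtain c N where c: "\<And>k. N \<le> k \<Longrightarrow> star A (S k) \<otimes> x \<otimes> S k = c \<odot> \<one>"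
      and wxw: "w \<otimes> x \<otimes> w = c \<odot> (w \<otimes> w)"
      using word_span_compression[OF x(1)] w by metis
    have x_closed: "x \<in> carrier A"
      using x by blast
    \<comment> \<open>The compression of \<open>star A w\<close> vanishes, so
      \<open>c \<odot> \<one>\<close> is the compression of \<open>x \<ominus> star A w\<close> and
      no larger in norm.\<close>
    have "star A (S N) \<otimes> star A w = star A (w \<otimes> S N)"
      using w(1) by (simp add: star_mult)
    then have "star A (S N) \<otimes> star A w = \<zero>"
      using w(2) by simp
    then have "star A (S N) \<otimes> (x \<ominus> star A w) \<otimes> S N = c \<odot> \<one>"
      using c[of N] w(1) x_closed by (simp add: minus_eq r_distr l_distr r_minus l_minus)
    then have "cmod c \<le> nrm A (x \<ominus> star A w)"
      using nrm_compression_le[of "x \<ominus> star A w" N] w(1) x_closed by (simp add: nrm_smult)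
    then have "cmod c \<le> d"
      using x(2) w(1) x_closed by (simp add: nrm_diff_commute)
    have "nrm A (w \<otimes> (star A w \<ominus> x) \<otimes> w) \<le> nrm A w * d * nrm A w"
      using w(1) x x_closed by (intro nrm_mult_le) auto
    moreover have "nrm A (c \<odot> (w \<otimes> w)) \<le> d * b"
      using w(1) nrm_mult[of w w] \<open>cmod c \<le> d\<close> \<open>0 < d\<close>
      by (simp add: nrm_smult b_def mult_mono)
    moreover have "w \<otimes> star A w \<otimes> w = w \<otimes> (star A w \<ominus> x) \<otimes> w \<oplus> w \<otimes> x \<otimes> w"
      using w(1) x_closed star_closed[OF w(1)] by algebra
    ultimately have "nrm A (w \<otimes> star A w \<otimes> w) \<le> d * (2 * b)"
      using nrm_add[of "w \<otimes> (star A w \<ominus> x) \<otimes> w" "w \<otimes> x \<otimes> w"] w(1) x_closed wxw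
      by (simp add: b_def mult_ac)
    also have "\<dots> \<le> e"
      using \<open>0 < e\<close> \<open>0 \<le> b\<close> by (simp add: d_def field_simps)
    finally show ?thesis .
  qed
  then have zero: "w \<otimes> star A w \<otimes> w = \<zero>"
    using w(1) by (intro eq_if_nrm_diff_small) (auto simp: minus_eq)
  \<comment> \<open>The C*-identity is used twice: for \<open>p = \<zero>\<close>, then for
    \<open>w = \<zero>\<close>.\<close>
  define p where "p = star A w \<otimes> w"
  have "star A p \<otimes> p = star A w \<otimes> (w \<otimes> star A w \<otimes> w)"
    using w(1) by (simp add: p_def star_mult m_assoc)
  then have "star A p \<otimes> p = \<zero>"
    using w(1) zero by simp
  then have "nrm A p = 0"
    using cstar_identity[of p] w(1) by (simp add: p_def)
  then show ?thesis
    using cstar_identity[of w] w(1) nrm_eq_zero[of w] by (simp add: p_def)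
qed

text \<open>Commutation makes all compressions of \<open>u\<close> equal to one \<open>q\<close>;
  density of words makes \<open>q\<close> a scalar, and \<open>annihilator_of_generators\<close>
  removes the difference \<open>u \<ominus> q\<close>.\<close>

lemma commutant_trivial:
  assumes u: "u \<in> carrier A"
    and comm: "\<And>i j. u \<otimes> (S i \<otimes> star A (S j)) = (S i \<otimes> star A (S j)) \<otimes> u"
  obtains c where "u = c \<odot> \<one>"
proof -
  have u_gen: "u \<otimes> S i = S i \<otimes> (star A (S j) \<otimes> u \<otimes> S j)" for i j
  proof -
    \<comment> \<open>Inserting \<open>star A (S j) \<otimes> S j = \<one>\<close> creates an
      element with which \<open>u\<close> commutes.\<close>
    have "u \<otimes> S i = u \<otimes> (S i \<otimes> star A (S j)) \<otimes> S j"
      using u by (simp add: m_assoc star_gen_mult_gen)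
    also have "\<dots> = S i \<otimes> star A (S j) \<otimes> u \<otimes> S j"
      by (simp only: comm)
    finally show ?thesis
      using u by (simp add: m_assoc)
  qed
  define q where "q = star A (S 0) \<otimes> u \<otimes> S 0"
  have q: "star A (S k) \<otimes> u \<otimes> S k = q" for k
  proof -
    have "star A (S k) \<otimes> (u \<otimes> S k) = star A (S k) \<otimes> (S k \<otimes> q)"
      unfolding u_gen[of k 0] q_def ..
    also have "\<dots> = q"
      using u by (simp add: q_def star_gen_mult_gen flip: m_assoc)
    finally show ?thesis
      using u by (simp add: m_assoc)
  qed
  have "\<exists>c. nrm A (q \<ominus> c \<odot> \<one>) < e" if "0 < e" for e
  proof -
    obtain x where x: "x \<in> word_span" "nrm A (u \<ominus> x) < e"
      using word_span_dense[OF u \<open>0 < e\<close>] .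
    obtain c N where c: "\<And>k. N \<le> k \<Longrightarrow> star A (S k) \<otimes> x \<otimes> S k = c \<odot> \<one>"
      using word_span_compression[OF x(1)] by metis
    \<comment> \<open>\<open>q\<close> is the compression by every \<open>S k\<close>, so the index
      can be \<open>N\<close>, where the compression of \<open>x\<close> is already a
      scalar.\<close>
    have "star A (S N) \<otimes> (u \<ominus> x) \<otimes> S N = q \<ominus> c \<odot> \<one>"
      using c[of N] q[of N] u x(1) by (simp add: minus_eq r_distr l_distr r_minus l_minus)
    then have "nrm A (q \<ominus> c \<odot> \<one>) < e"
      using nrm_compression_le[of "u \<ominus> x" N] u x by simp
    then show ?thesis ..
  qed
  then obtain c where "q = c \<odot> \<one>"
    using scalars_closed[of q] u by (auto simp: q_def)
  define w where "w = u \<ominus> c \<odot> \<one>"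
  have gen_comm: "u \<otimes> S k = c \<odot> S k" "star A (S k) \<otimes> u = c \<odot> star A (S k)" for k
  proof -
    show "u \<otimes> S k = c \<odot> S k"
      using u_gen[of k k] q \<open>q = c \<odot> \<one>\<close> by (simp add: smult_mult_right)
    have "star A (S k) \<otimes> u = star A (S k) \<otimes> (S k \<otimes> star A (S k)) \<otimes> u"
      using u by (simp add: star_gen_mult_gen flip: m_assoc)
    also have "\<dots> = star A (S k) \<otimes> (u \<otimes> (S k \<otimes> star A (S k)))"
      unfolding comm using u by (simp add: m_assoc)
    also have "\<dots> = q \<otimes> star A (S k)"
      using u q by (simp flip: m_assoc)
    finally show "star A (S k) \<otimes> u = c \<odot> star A (S k)"
      by (simp add: \<open>q = c \<odot> \<one>\<close> smult_mult_left)
  qed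
  have "w = \<zero>"
    by (rule annihilator_of_generators)
      (use u in \<open>auto simp: w_def minus_eq r_distr l_distr r_minus l_minus gen_comm
        smult_mult_left smult_mult_right M.r_neg\<close>)
  then have "u = c \<odot> \<one>"
    using u eq_if_diff_zero[of u "c \<odot> \<one>"] by (simp add: w_def)
  then show thesis ..
qed

section \<open>Uniqueness on generators and the gauge action\<close>

text \<open>Equality passes from generators to words algebraically, and then to the whole algebra
  because words are dense and both maps are contractive.\<close>

lemma star_hom_eq_if_eq_on_generators:
  assumes "unital_cstar_algebra B" "f \<in> star_hom A B" "g \<in> star_hom A B"
    and gen: "\<And>i. f (S i) = g (S i)" and x: "x \<in> carrier A"
  shows "f x = g x"
proof -
  interpret B: unital_cstar_algebra B
    by fact
  interpret f: cstar_hom A B f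
    by unfold_locales fact
  interpret g: cstar_hom A B g
    by unfold_locales fact
  have words: "f y = g y" if "y \<in> word_span" for y
    using that by induction (auto simp: f.hom_simps g.hom_simps gen)
  show ?thesis
  proof (rule B.eq_if_nrm_diff_small)
    fix e :: real assume "0 < e"
    then obtain y where y: "y \<in> word_span" "nrm A (x \<ominus> y) < e / 2"
      using word_span_dense[OF x] half_gt_zero by blast
    have "nrm B (f x \<ominus>\<^bsub>B\<^esub> f y) < e / 2"
      using f.nrm_hom_le[of "x \<ominus> y"] y x by (simp add: f.hom_diff)
    moreover have "nrm B (f y \<ominus>\<^bsub>B\<^esub> g x) < e / 2"
      using g.nrm_hom_le[of "x \<ominus> y"] y x words[OF y(1)]
      by (simp add: g.hom_diff g.hom_simps B.nrm_diff_commute)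
    ultimately show "nrm B (f x \<ominus>\<^bsub>B\<^esub> g x) \<le> e"
      using B.nrm_diff_triangle[of "f x" "f y" "g x"] x y(1)
      by (simp add: f.hom_simps g.hom_simps)
  qed (use x in \<open>auto simp: f.hom_simps g.hom_simps\<close>)
qed

lemma cstar_aut_eqI:
  assumes "\<phi> \<in> cstar_aut A" "\<psi> \<in> cstar_aut A" "\<And>i. \<phi> (S i) = \<psi> (S i)"
  shows "\<phi> = \<psi>"
proof (rule extensionalityI)
  show "\<phi> \<in> extensional (carrier A)" "\<psi> \<in> extensional (carrier A)"
    using assms by (auto simp: cstar_aut_def Bij_def)
  show "\<phi> x = \<psi> x" if "x \<in> carrier A" for x
    by (rule star_hom_eq_if_eq_on_generators[OF unital_cstar_algebra_axioms])
      (use assms that in \<open>auto simp: cstar_aut_def\<close>)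
qed

lemma unit_circle_mult_cnj:
  assumes "z \<in> unit_circle"
  shows "z * cnj z = 1" "cnj z * z = 1"
proof -
  show "z * cnj z = 1"
    using assms complex_norm_square[of z] by simp
  then show "cnj z * z = 1"
    by (simp add: mult.commute)
qed

text \<open>For \<open>z\<close> of modulus 1 the \<open>z \<odot> S i\<close> again satisfy the
  Cuntz relations, so the universal property gives an endomorphism. The one for \<open>cnj z\<close>
  is its inverse, since the composites fix the generators.\<close>

lemma gauge_exists:
  assumes "z \<in> unit_circle"
  obtains \<tau> where "\<tau> \<in> cstar_aut A" "\<And>i. \<tau> (S i) = z \<odot> S i"
proof -
  have ex: "\<exists>f\<in>star_hom A A. \<forall>i. f (S i) = w \<odot> S i" if "w \<in> unit_circle" for w
  proof -
    have "cuntz_family A (\<lambda>i. w \<odot> S i)"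
      unfolding cuntz_family_def
      by (auto simp: star_smult smult_mult_left smult_mult_right scale_scale star_gen_mult_gen
          unit_circle_mult_cnj[OF that])
    then show ?thesis
      using Cuntz unital_cstar_algebra_axioms unfolding is_Cuntz_infinity_def by blast
  qed
  obtain f where f: "f \<in> star_hom A A" "\<And>i. f (S i) = z \<odot> S i"
    using ex[OF assms] by blast
  obtain g where g: "g \<in> star_hom A A" "\<And>i. g (S i) = cnj z \<odot> S i"
    using ex[of "cnj z"] assms by auto
  note f_simps = star_hom_simps[OF f(1)] and g_simps = star_hom_simps[OF g(1)]
  have "(\<lambda>x. x) \<in> star_hom A A" "f \<circ> g \<in> star_hom A A" "g \<circ> f \<in> star_hom A A"
    unfolding star_hom_def ring_hom_def by (auto simp: f_simps g_simps)
  then have "f (g x) = x" "g (f x) = x" if "x \<in> carrier A" for x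
    using star_hom_eq_if_eq_on_generators[OF unital_cstar_algebra_axioms _ _ _ that,
        of "f \<circ> g" "\<lambda>x. x"]
      star_hom_eq_if_eq_on_generators[OF unital_cstar_algebra_axioms _ _ _ that,
        of "g \<circ> f" "\<lambda>x. x"]
    by (simp_all add: f(2) g(2) f_simps g_simps scale_scale unit_circle_mult_cnj[OF assms])
  then have "bij_betw f (carrier A) (carrier A)"
    by (intro bij_betw_byWitness[of _ g]) (auto simp: f_simps g_simps)
  then have "restrict f (carrier A) \<in> cstar_aut A"
    using star_hom_restrict[OF f(1) unital_cstar_algebra_axioms]
    by (auto simp: cstar_aut_def Bij_def cong: bij_betw_cong)
  then show thesis
    using that f(2) by simp
qed

text \<open>Existence and uniqueness justify the definite description in
  \<open>gauge_action\<close>.\<close>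

lemma gauge_action:
  assumes "z \<in> unit_circle"
  shows gauge_action_aut: "gauge_action A S z \<in> cstar_aut A"
    and gauge_action_gen: "gauge_action A S z (S i) = z \<odot> S i"
proof -
  have "\<exists>!\<tau>. \<tau> \<in> cstar_aut A \<and> (\<forall>i. \<tau> (S i) = z \<odot> S i)"
    using gauge_exists[OF assms] cstar_aut_eqI by metis
  then have "gauge_action A S z \<in> cstar_aut A \<and> (\<forall>i. gauge_action A S z (S i) = z \<odot> S i)"
    unfolding gauge_action_def by (rule theI')
  then show "gauge_action A S z \<in> cstar_aut A" "gauge_action A S z (S i) = z \<odot> S i"
    by auto
qed

lemma gauge_action_eqI:
  "\<lbrakk>z \<in> unit_circle; \<phi> \<in> cstar_aut A; \<And>i. \<phi> (S i) = z \<odot> S i\<rbrakk> \<Longrightarrow> gauge_action A S z = \<phi>"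
  using cstar_aut_eqI gauge_action by metis

lemma gauge_action_hom: "z \<in> unit_circle \<Longrightarrow> gauge_action A S z \<in> star_hom A A"
  using gauge_action_aut by (auto simp: cstar_aut_def)

lemmas gauge_simps = star_hom_simps[OF gauge_action_hom] gauge_action_gen

lemma gauge_action_fixing:
  "z \<in> unit_circle \<Longrightarrow> gauge_action A S z \<in> cstar_aut_fixing A (gauge_fixed A S)"
  using gauge_action_aut by (auto simp: cstar_aut_fixing_def gauge_fixed_def)

lemma gauge_action_mult:
  assumes "z \<in> unit_circle" "w \<in> unit_circle"
  shows "gauge_action A S (z * w)
    = compose (carrier A) (gauge_action A S z) (gauge_action A S w)"
proof (rule gauge_action_eqI)
  let ?c = "compose (carrier A) (gauge_action A S z) (gauge_action A S w)"
  show "z * w \<in> unit_circle"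
    using assms by (simp add: norm_mult)
  have "?c \<in> star_hom A A"
    unfolding star_hom_def ring_hom_def compose_def
    using assms by (auto simp: gauge_simps)
  then show "?c \<in> cstar_aut A"
    using gauge_action_aut assms by (auto simp: cstar_aut_def intro: compose_Bij)
  show "?c (S i) = (z * w) \<odot> S i" for i
    using assms by (simp add: compose_def gauge_simps scale_scale mult.commute)
qed

lemma gauge_action_inj: "inj_on (gauge_action A S) unit_circle"
proof (rule inj_onI)
  fix z w assume "z \<in> unit_circle" "w \<in> unit_circle" "gauge_action A S z = gauge_action A S w"
  then have "(z - w) \<odot> S 0 = \<zero>"
    using gauge_action_gen[of z 0] gauge_action_gen[of w 0] by (simp add: diff_scale)
  then have "cmod (z - w) * nrm A (S 0) = 0"
    using nrm_smult[of "S 0" "z - w"] by simp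
  then show "z = w"
    by simp
qed

section \<open>Automorphisms fixing the core\<close>

lemma one_gauge_fixed: "\<one> \<in> gauge_fixed A S"
  by (auto simp: gauge_fixed_def gauge_simps)

text \<open>The phases \<open>z\<close> and \<open>cnj z\<close> cancel. The case
  \<open>a = \<one>\<close> puts every \<open>S i \<otimes> star A (S j)\<close> into the
  core.\<close>

lemma gauge_fixed_sandwich:
  assumes "a \<in> gauge_fixed A S"
  shows "S i \<otimes> a \<otimes> star A (S j) \<in> gauge_fixed A S"
  using assms
  by (auto simp: gauge_fixed_def gauge_simps star_smult smult_mult_left smult_mult_right
      scale_scale unit_circle_mult_cnj)

lemma aut_fixing_is_gauge:
  assumes "\<phi> \<in> cstar_aut_fixing A (gauge_fixed A S)"
  obtains z where "z \<in> unit_circle" "\<phi> = gauge_action A S z"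
proof -
  have aut: "\<phi> \<in> cstar_aut A" and hom: "\<phi> \<in> star_hom A A"
    and fixes_core: "\<And>a. a \<in> gauge_fixed A S \<Longrightarrow> \<phi> a = a"
    using assms by (auto simp: cstar_aut_fixing_def cstar_aut_def)
  note h = star_hom_simps[OF hom]
  \<comment> \<open>The only candidate: \<open>\<phi> (S 0) = S 0 \<otimes> u\<close> forces this
    value.\<close>
  define u where "u = star A (S 0) \<otimes> \<phi> (S 0)"
  have u: "u \<in> carrier A"
    by (simp add: u_def h)
  have gen_star: "\<phi> (S i) \<otimes> star A (\<phi> (S j)) = S i \<otimes> star A (S j)" for i j
    using fixes_core[OF gauge_fixed_sandwich[OF one_gauge_fixed], of i j] by (simp add: h)
  have star_gen: "star A (\<phi> (S i)) \<otimes> \<phi> (S i) = \<one>" for i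
  proof -
    have "star A (\<phi> (S i)) \<otimes> \<phi> (S i) = \<phi> (star A (S i) \<otimes> S i)"
      by (simp add: h)
    then show ?thesis
      by (simp add: star_gen_mult_gen h)
  qed
  have \<phi>_gen: "\<phi> (S i) = S i \<otimes> u" for i
  proof -
    \<comment> \<open>Writing \<open>\<one>\<close> in this form brings in
      \<open>\<phi> (S i) \<otimes> star A (\<phi> (S 0))\<close>, which equals
      \<open>S i \<otimes> star A (S 0)\<close>.\<close>
    have "\<phi> (S i) = \<phi> (S i) \<otimes> (star A (\<phi> (S 0)) \<otimes> \<phi> (S 0))"
      by (simp add: star_gen h)
    also have "\<dots> = \<phi> (S i) \<otimes> star A (\<phi> (S 0)) \<otimes> \<phi> (S 0)"
      by (simp add: m_assoc h)
    finally show ?thesis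
      by (simp add: gen_star u_def m_assoc h)
  qed
  have "u \<otimes> star A u = star A (S 0) \<otimes> (\<phi> (S 0) \<otimes> star A (\<phi> (S 0))) \<otimes> S 0"
    by (simp add: u_def star_mult m_assoc h)
  also have "\<dots> = star A (S 0) \<otimes> S 0 \<otimes> (star A (S 0) \<otimes> S 0)"
    unfolding gen_star by (simp add: m_assoc)
  finally have u_star: "u \<otimes> star A u = \<one>"
    by (simp add: star_gen_mult_gen)
  have "star A (\<phi> (S 0)) \<otimes> \<phi> (S 0) = star A u \<otimes> (star A (S 0) \<otimes> S 0) \<otimes> u"
    using u by (simp add: \<phi>_gen star_mult m_assoc)
  then have star_u: "star A u \<otimes> u = \<one>"
    using u by (simp add: star_gen star_gen_mult_gen)
  have comm: "u \<otimes> a = a \<otimes> u" if a: "a \<in> gauge_fixed A S" for a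
  proof -
    have a': "a \<in> carrier A"
      using a by (simp add: gauge_fixed_def)
    \<comment> \<open>This element and \<open>a\<close> are both fixed, while \<open>\<phi>\<close>
      conjugates the inner \<open>a\<close> by \<open>u\<close>; compressing by \<open>S 0\<close>
      isolates \<open>a = u \<otimes> a \<otimes> star A u\<close>.\<close>
    have "S 0 \<otimes> a \<otimes> star A (S 0) = \<phi> (S 0 \<otimes> a \<otimes> star A (S 0))"
      using fixes_core[OF gauge_fixed_sandwich[OF a]] by simp
    also have "\<dots> = S 0 \<otimes> (u \<otimes> a \<otimes> star A u) \<otimes> star A (S 0)"
      using a' u fixes_core[OF a] by (simp add: h \<phi>_gen star_mult m_assoc)
    finally have "star A (S 0) \<otimes> (S 0 \<otimes> a \<otimes> star A (S 0)) \<otimes> S 0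
        = star A (S 0) \<otimes> (S 0 \<otimes> (u \<otimes> a \<otimes> star A u) \<otimes> star A (S 0)) \<otimes> S 0"
      by simp
    moreover have "star A (S 0) \<otimes> (S 0 \<otimes> b \<otimes> star A (S 0)) \<otimes> S 0 = b" if "b \<in> carrier A" for b
    proof -
      have "star A (S 0) \<otimes> (S 0 \<otimes> b \<otimes> star A (S 0)) \<otimes> S 0
          = (star A (S 0) \<otimes> S 0) \<otimes> b \<otimes> (star A (S 0) \<otimes> S 0)"
        using that by (simp add: m_assoc)
      then show ?thesis
        using that by (simp add: star_gen_mult_gen)
    qed
    ultimately have "a = u \<otimes> a \<otimes> star A u"
      using a' u by simp
    then have "a \<otimes> u = u \<otimes> a \<otimes> star A u \<otimes> u"
      by simp
    also have "\<dots> = u \<otimes> a \<otimes> (star A u \<otimes> u)"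
      using a' u by (simp add: m_assoc)
    finally show ?thesis
      using a' u by (simp add: star_u)
  qed
  have "S i \<otimes> star A (S j) \<in> gauge_fixed A S" for i j
    using gauge_fixed_sandwich[OF one_gauge_fixed, of i j] by simp
  then obtain z where z: "u = z \<odot> \<one>"
    using commutant_trivial[OF u] comm by metis
  have "nrm A u = 1"
    using star_u u by (intro nrm_isometry)
  then have "z \<in> unit_circle"
    by (simp add: z nrm_smult)
  moreover have "gauge_action A S z = \<phi>"
    using \<open>z \<in> unit_circle\<close> aut by (intro gauge_action_eqI) (simp_all add: \<phi>_gen z smult_mult_right)
  ultimately show thesis
    using that by blast
qed

lemma aut_fixing_eq_gauge:
  "cstar_aut_fixing A (gauge_fixed A S) = gauge_action A S ` unit_circle"
proof
  show "cstar_aut_fixing A (gauge_fixed A S) \<subseteq> gauge_action A S ` unit_circle"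
    using aut_fixing_is_gauge by blast
  show "gauge_action A S ` unit_circle \<subseteq> cstar_aut_fixing A (gauge_fixed A S)"
    using gauge_action_fixing by blast
qed

lemma gauge_action_iso:
  "gauge_action A S \<in> iso circle_group (Aut_fixing_group A (gauge_fixed A S))"
proof (rule isoI)
  have "gauge_action A S (z * w)
      = gauge_action A S z \<otimes>\<^bsub>Aut_fixing_group A (gauge_fixed A S)\<^esub> gauge_action A S w"
    if "z \<in> unit_circle" "w \<in> unit_circle" for z w
    using gauge_action_mult[OF that] gauge_action_aut that
    by (simp add: Aut_fixing_group_def BijGroup_def cstar_aut_def)
  then show "gauge_action A S \<in> hom circle_group (Aut_fixing_group A (gauge_fixed A S))"
    using gauge_action_fixing
    by (intro homI) (auto simp: circle_group_def Aut_fixing_group_def)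
  show "bij_betw (gauge_action A S) (carrier circle_group)
      (carrier (Aut_fixing_group A (gauge_fixed A S)))"
    using gauge_action_inj aut_fixing_eq_gauge
    by (simp add: bij_betw_def circle_group_def Aut_fixing_group_def)
qed

section \<open>Point-norm continuity of the gauge action\<close>

lemma nrm_gauge_action_le: "\<lbrakk>z \<in> unit_circle; x \<in> carrier A\<rbrakk> \<Longrightarrow> nrm A (gauge_action A S z x) \<le> nrm A x"
  using cstar_hom.nrm_hom_le[of A A "gauge_action A S z" x] gauge_action_hom[of z]
    unital_cstar_algebra_axioms
  by (simp add: cstar_hom_def cstar_hom_axioms_def)

lemma gauge_action_diff:
  "\<lbrakk>z \<in> unit_circle; x \<in> carrier A; y \<in> carrier A\<rbrakk>
    \<Longrightarrow> gauge_action A S z (x \<ominus> y) = gauge_action A S z x \<ominus> gauge_action A S z y"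
  using cstar_hom.hom_diff[of A A "gauge_action A S z" x y] gauge_action_hom[of z]
    unital_cstar_algebra_axioms
  by (simp add: cstar_hom_def cstar_hom_axioms_def)

text \<open>A product rule for Lipschitz bounds, accounting for the phase that one more letter
  contributes.\<close>

lemma nrm_scale_diff_le:
  assumes "x \<in> carrier A" "y \<in> carrier A" "cmod w = 1" "nrm A (x \<ominus> y) \<le> L * cmod (z - w)"
  shows "nrm A (z \<odot> x \<ominus> w \<odot> y) \<le> (nrm A x + L) * cmod (z - w)"
proof -
  have "z \<odot> x \<ominus> w \<odot> y = (z \<odot> x \<ominus> w \<odot> x) \<oplus> (w \<odot> x \<ominus> w \<odot> y)"
    using scale_closed[OF assms(1)] scale_closed[OF assms(2)] by algebra
  also have "\<dots> = (z - w) \<odot> x \<oplus> w \<odot> (x \<ominus> y)"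
    using assms by (simp add: diff_scale scale_diff)
  finally have "nrm A (z \<odot> x \<ominus> w \<odot> y) \<le> nrm A ((z - w) \<odot> x) + nrm A (w \<odot> (x \<ominus> y))"
    using assms by (simp add: nrm_add)
  then show ?thesis
    using assms by (simp add: nrm_smult algebra_simps)
qed

text \<open>Each further letter contributes a phase, which raises the constant by the norm of the
  remaining factor, starting from 0 for \<open>\<one>\<close>.\<close>

lemma gauge_action_Lipschitz:
  assumes "x \<in> word_span"
  obtains L where "0 \<le> L" "\<And>z w. \<lbrakk>z \<in> unit_circle; w \<in> unit_circle\<rbrakk>
    \<Longrightarrow> nrm A (gauge_action A S z x \<ominus> gauge_action A S w x) \<le> L * cmod (z - w)"
proof -
  have "\<exists>L\<ge>0. \<forall>z\<in>unit_circle. \<forall>w\<in>unit_circle.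
      nrm A (gauge_action A S z x \<ominus> gauge_action A S w x) \<le> L * cmod (z - w)"
    using assms
  proof (induction rule: word_span.induct)
    case one
    show ?case
      by (rule exI[of _ 0]) (auto simp: gauge_simps)
  next
    case (gen_mult x i)
    then obtain L where L: "0 \<le> L" "\<forall>z\<in>unit_circle. \<forall>w\<in>unit_circle.
        nrm A (gauge_action A S z x \<ominus> gauge_action A S w x) \<le> L * cmod (z - w)"
      by blast
    have "nrm A (gauge_action A S z (S i \<otimes> x) \<ominus> gauge_action A S w (S i \<otimes> x))
        \<le> (nrm A x + L) * cmod (z - w)" if zw: "z \<in> unit_circle" "w \<in> unit_circle" for z w
    proof -
      let ?g = "\<lambda>z. gauge_action A S z x"
      have g: "?g z \<in> carrier A" "?g w \<in> carrier A"
        using gen_mult zw by (auto simp: gauge_simps)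
      have "nrm A (S i \<otimes> ?g z \<ominus> S i \<otimes> ?g w) = nrm A (S i \<otimes> (?g z \<ominus> ?g w))"
        using g by (simp add: minus_eq r_distr r_minus)
      also have "\<dots> \<le> L * cmod (z - w)"
        using nrm_mult_le[of "S i" "?g z \<ominus> ?g w" 1 "L * cmod (z - w)"] L zw g by simp
      finally have "nrm A (z \<odot> (S i \<otimes> ?g z) \<ominus> w \<odot> (S i \<otimes> ?g w))
          \<le> (nrm A (S i \<otimes> ?g z) + L) * cmod (z - w)"
        using g zw by (intro nrm_scale_diff_le) auto
      \<comment> \<open>Contractivity replaces a norm depending on \<open>z\<close> by one that does
        not.\<close>
      moreover have "nrm A (S i \<otimes> ?g z) \<le> nrm A x"
        using nrm_mult_le[of "S i" "?g z" 1 "nrm A x"] nrm_gauge_action_le[of z x] gen_mult zw g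
        by auto
      then have "(nrm A (S i \<otimes> ?g z) + L) * cmod (z - w) \<le> (nrm A x + L) * cmod (z - w)"
        by (intro mult_right_mono) auto
      ultimately show ?thesis
        using gen_mult zw g by (simp add: gauge_simps smult_mult_left)
    qed
    moreover have "0 \<le> nrm A x + L"
      using L(1) gen_mult by auto
    ultimately show ?case
      by blast
  next
    case (mult_star_gen x i)
    then obtain L where L: "0 \<le> L" "\<forall>z\<in>unit_circle. \<forall>w\<in>unit_circle.
        nrm A (gauge_action A S z x \<ominus> gauge_action A S w x) \<le> L * cmod (z - w)"
      by blast
    have "nrm A (gauge_action A S z (x \<otimes> star A (S i)) \<ominus> gauge_action A S w (x \<otimes> star A (S i)))
        \<le> (nrm A x + L) * cmod (z - w)" if zw: "z \<in> unit_circle" "w \<in> unit_circle" for z w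
    proof -
      let ?g = "\<lambda>z. gauge_action A S z x"
      have g: "?g z \<in> carrier A" "?g w \<in> carrier A"
        using mult_star_gen zw by (auto simp: gauge_simps)
      have "nrm A (?g z \<otimes> star A (S i) \<ominus> ?g w \<otimes> star A (S i))
          = nrm A ((?g z \<ominus> ?g w) \<otimes> star A (S i))"
        using g by (simp add: minus_eq l_distr l_minus)
      also have "\<dots> \<le> L * cmod (z - w)"
        using nrm_mult_le[of "?g z \<ominus> ?g w" "star A (S i)" "L * cmod (z - w)" 1] L zw g by simp
      \<comment> \<open>A starred generator contributes \<open>cnj z\<close>; conjugation preserves
        distances, so \<open>nrm_scale_diff_le\<close> applies to the conjugates.\<close>
      also have "\<dots> = L * cmod (cnj z - cnj w)"
        by (simp flip: complex_cnj_diff)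
      finally have "nrm A (cnj z \<odot> (?g z \<otimes> star A (S i)) \<ominus> cnj w \<odot> (?g w \<otimes> star A (S i)))
          \<le> (nrm A (?g z \<otimes> star A (S i)) + L) * cmod (cnj z - cnj w)"
        using g zw by (intro nrm_scale_diff_le) auto
      also have "\<dots> = (nrm A (?g z \<otimes> star A (S i)) + L) * cmod (z - w)"
        by (simp flip: complex_cnj_diff)
      finally have "nrm A (cnj z \<odot> (?g z \<otimes> star A (S i)) \<ominus> cnj w \<odot> (?g w \<otimes> star A (S i)))
          \<le> (nrm A (?g z \<otimes> star A (S i)) + L) * cmod (z - w)" .
      moreover have "nrm A (?g z \<otimes> star A (S i)) \<le> nrm A x"
        using nrm_mult_le[of "?g z" "star A (S i)" "nrm A x" 1] nrm_gauge_action_le[of z x]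
          mult_star_gen zw g by auto
      then have "(nrm A (?g z \<otimes> star A (S i)) + L) * cmod (z - w) \<le> (nrm A x + L) * cmod (z - w)"
        by (intro mult_right_mono) auto
      ultimately show ?thesis
        using mult_star_gen zw g by (simp add: gauge_simps star_smult smult_mult_right)
    qed
    moreover have "0 \<le> nrm A x + L"
      using L(1) mult_star_gen by auto
    ultimately show ?case
      by blast
  next
    case (add x y)
    then obtain K L where K: "0 \<le> K" "\<forall>z\<in>unit_circle. \<forall>w\<in>unit_circle.
        nrm A (gauge_action A S z x \<ominus> gauge_action A S w x) \<le> K * cmod (z - w)"
      and L: "0 \<le> L" "\<forall>z\<in>unit_circle. \<forall>w\<in>unit_circle.
        nrm A (gauge_action A S z y \<ominus> gauge_action A S w y) \<le> L * cmod (z - w)"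
      by blast
    have "nrm A (gauge_action A S z (x \<oplus> y) \<ominus> gauge_action A S w (x \<oplus> y))
        \<le> (K + L) * cmod (z - w)" if zw: "z \<in> unit_circle" "w \<in> unit_circle" for z w
    proof -
      let ?g = "gauge_action A S"
      have g: "?g z x \<in> carrier A" "?g w x \<in> carrier A" "?g z y \<in> carrier A" "?g w y \<in> carrier A"
        using add zw by (auto simp: gauge_simps)
      have "?g z x \<oplus> ?g z y \<ominus> (?g w x \<oplus> ?g w y) = (?g z x \<ominus> ?g w x) \<oplus> (?g z y \<ominus> ?g w y)"
        using g by algebra
      then have "nrm A (?g z (x \<oplus> y) \<ominus> ?g w (x \<oplus> y))
          \<le> nrm A (?g z x \<ominus> ?g w x) + nrm A (?g z y \<ominus> ?g w y)"
        using add zw g by (simp add: gauge_simps nrm_add)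
      also have "\<dots> \<le> K * cmod (z - w) + L * cmod (z - w)"
        using K L zw by (intro add_mono) auto
      finally show ?thesis
        by (simp add: distrib_right)
    qed
    then show ?case
      using K(1) L(1) by (intro exI[of _ "K + L"]) auto
  next
    case (smult x c)
    then obtain L where L: "0 \<le> L" "\<forall>z\<in>unit_circle. \<forall>w\<in>unit_circle.
        nrm A (gauge_action A S z x \<ominus> gauge_action A S w x) \<le> L * cmod (z - w)"
      by blast
    have "nrm A (gauge_action A S z (c \<odot> x) \<ominus> gauge_action A S w (c \<odot> x))
        \<le> (cmod c * L) * cmod (z - w)" if zw: "z \<in> unit_circle" "w \<in> unit_circle" for z w
    proof -
      have "nrm A (gauge_action A S z (c \<odot> x) \<ominus> gauge_action A S w (c \<odot> x))
          = cmod c * nrm A (gauge_action A S z x \<ominus> gauge_action A S w x)"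
        using smult zw by (simp add: gauge_simps nrm_smult flip: scale_diff)
      also have "\<dots> \<le> cmod c * (L * cmod (z - w))"
        using L zw by (intro mult_left_mono) auto
      finally show ?thesis
        by (simp add: mult.assoc)
    qed
    then show ?case
      using L(1) by (intro exI[of _ "cmod c * L"]) auto
  qed
  then show thesis
    using that by blast
qed

text \<open>Some \<open>x\<close> in \<open>word_span\<close> lies within \<open>e / 3\<close> of
  \<open>a\<close>, contractivity keeps this error uniform over the circle, and the orbit of
  \<open>x\<close> is Lipschitz.\<close>

lemma continuous_gauge_orbit:
  assumes a: "a \<in> carrier A"
  shows "continuous_map (top_of_set unit_circle) (norm_topology A) (\<lambda>z. gauge_action A S z a)"
proof -
  interpret M: Metric_space "carrier A" "norm_dist A"
    by (rule Metric_space_norm_dist)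
  let ?g = "gauge_action A S"
  have "\<exists>U. openin (top_of_set unit_circle) U \<and> z \<in> U \<and> (\<forall>w\<in>U. ?g w a \<in> M.mball (?g z a) e)"
    if z: "z \<in> unit_circle" and "0 < e" for z e
  proof -
    obtain x where x: "x \<in> word_span" "nrm A (a \<ominus> x) < e / 3"
      using word_span_dense[OF a, of "e / 3"] \<open>0 < e\<close> by auto
    obtain L where L: "0 \<le> L" "\<And>z w. \<lbrakk>z \<in> unit_circle; w \<in> unit_circle\<rbrakk>
        \<Longrightarrow> nrm A (?g z x \<ominus> ?g w x) \<le> L * cmod (z - w)"
      using gauge_action_Lipschitz[OF x(1)] by blast
    have close: "nrm A (?g w a \<ominus> ?g w x) < e / 3" if "w \<in> unit_circle" for w
      using nrm_gauge_action_le[OF that, of "a \<ominus> x"] x a that by (simp add: gauge_action_diff)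
    have "?g w a \<in> M.mball (?g z a) e" if w: "w \<in> unit_circle" "dist z w < e / (3 * (L + 1))" for w
    proof -
      have g: "?g z a \<in> carrier A" "?g w a \<in> carrier A" "?g z x \<in> carrier A" "?g w x \<in> carrier A"
        using z w a x by (auto simp: gauge_simps)
      have "L * cmod (z - w) \<le> L * (e / (3 * (L + 1)))"
        using w(2) L(1) by (intro mult_left_mono) (auto simp: dist_norm)
      also have "\<dots> \<le> e / 3"
        using L(1) \<open>0 < e\<close> by (simp add: field_simps)
      finally have "nrm A (?g z x \<ominus> ?g w x) \<le> e / 3"
        using L(2)[OF z w(1)] by linarith
      then have "nrm A (?g z a \<ominus> ?g w a) < e"
        using nrm_diff_triangle[OF g(1,3,2)] nrm_diff_triangle[OF g(3,4,2)]
          close[OF z] close[OF w(1)] nrm_diff_commute[OF g(2,4)] by linarith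
      then show ?thesis
        using g by (simp add: norm_dist_def)
    qed
    moreover have "0 < e / (3 * (L + 1))"
      using L(1) \<open>0 < e\<close> by simp
    ultimately show ?thesis
      using z by (intro exI[of _ "unit_circle \<inter> ball z (e / (3 * (L + 1)))"])
        (auto simp: openin_open_Int)
  qed
  then show ?thesis
    by (simp add: M.continuous_map_to_metric)
qed

text \<open>A continuous bijection from a compact space onto a Hausdorff space is a homeomorphism;
  continuity into the product topology is continuity of each orbit map.\<close>

lemma homeomorphic_gauge_action:
  "homeomorphic_map (top_of_set unit_circle)
     (point_norm_topology A (cstar_aut_fixing A (gauge_fixed A S))) (gauge_action A S)"
proof (rule continuous_imp_homeomorphic_map)
  interpret M: Metric_space "carrier A" "norm_dist A"
    by (rule Metric_space_norm_dist)
  let ?F = "cstar_aut_fixing A (gauge_fixed A S)"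
  \<comment> \<open>Being undefined off the carrier, the automorphisms are points of the product
    space, so the subtopology contains all of them.\<close>
  have PiE: "?F \<subseteq> carrier A \<rightarrow>\<^sub>E carrier A"
    by (auto simp: cstar_aut_fixing_def cstar_aut_def Bij_def PiE_def bij_betw_def)
  have top: "topspace (point_norm_topology A ?F) = ?F"
    using PiE by (auto simp: point_norm_topology_def)
  show "continuous_map (top_of_set unit_circle) (point_norm_topology A ?F) (gauge_action A S)"
    unfolding point_norm_topology_def continuous_map_in_subtopology continuous_map_componentwise
    using PiE continuous_gauge_orbit by (auto simp: aut_fixing_eq_gauge PiE_def)
  show "compact_space (top_of_set unit_circle)"
    by (simp add: compact_space_subtopology)
  show "Hausdorff_space (point_norm_topology A ?F)"
    unfolding point_norm_topology_def
    by (intro Hausdorff_space_subtopology)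
      (simp add: Hausdorff_space_product_topology M.Hausdorff_space_mtopology)
  show "gauge_action A S ` topspace (top_of_set unit_circle) = topspace (point_norm_topology A ?F)"
    using top by (simp add: aut_fixing_eq_gauge)
  show "inj_on (gauge_action A S) (topspace (top_of_set unit_circle))"
    using gauge_action_inj by simp
qed

end

theorem corollary5p2p1:
  fixes A :: "'a star_algebra" and S :: "nat \<Rightarrow> 'a"
  assumes "is_Cuntz_infinity A S"
  shows "cstar_aut_fixing A (gauge_fixed A S) = {gauge_action A S z | z. z \<in> unit_circle}
    \<and> gauge_action A S \<in> iso circle_group (Aut_fixing_group A (gauge_fixed A S))
    \<and> homeomorphic_map (top_of_set unit_circle)
        (point_norm_topology A (cstar_aut_fixing A (gauge_fixed A S))) (gauge_action A S)"
proof -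
  interpret unital_cstar_algebra A
    using assms by (simp add: is_Cuntz_infinity_def)
  interpret cuntz_infinity A S
    by unfold_locales fact
  have "cstar_aut_fixing A (gauge_fixed A S) = {gauge_action A S z | z. z \<in> unit_circle}"
    unfolding aut_fixing_eq_gauge by blast
  then show ?thesis
    using gauge_action_iso homeomorphic_gauge_action by blast
qed

end
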